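(* Let $a,b,c$ be positive integers with $(a,b,c)=1$. Then \begin{align*} -2m(x^a-1,x^b-1,x^c-1)&=abc\left(\frac{1}{[a,b]^3}+\frac{1}{[b,c]^3}+\frac{1}{[c,a]^3}\right)\zeta(3)\\ &\quad-\frac{\pi}{2c(a,b)}\sum_{\substack{h\geq1\\ b_a\nmid ch}}\frac{\cot\left(\pi\frac{[a_b^{-1}]_{b_a}ch}{b_a}\right)}{h^2}-\frac{\pi}{2b(a,c)}\sum_{\substack{h\geq1\\ c_a\nmid bh}}\frac{\cot\left(\pi\frac{[a_c^{-1}]_{c_a}bh}{c_a}\right)}{h^2}\\ &\quad-\frac{\pi}{2a(b,c)}\sum_{\substack{h\geq1\\ c_b\nmid ah}}\frac{\cot\left(\pi\frac{[b_c^{-1}]_{c_b}ah}{c_b}\right)}{h^2}-\frac{\pi}{2c(b,a)}\sum_{\substack{h\geq1\\ a_b\nmid ch}}\frac{\cot\left(\pi\frac{[b_a^{-1}]_{a_b}ch}{a_b}\right)}{h^2}\\ &\quad-\frac{\pi}{2b(c,a)}\sum_{\substack{h\geq1\\ a_c\nmid bh}}\frac{\cot\left(\pi\frac{[c_a^{-1}]_{a_c}bh}{a_c}\right)}{h^2}-\frac{\pi}{2a(c,b)}\sum_{\substack{h\geq1\\ b_c\nmid ah}}\frac{\cot\left(\pi\frac{[c_b^{-1}]_{b_c}ah}{b_c}\right)}{h^2}. \end{align*}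
   Context: $(\cdot,\cdot)$ denotes gcd, $[\cdot,\cdot]$ denotes lcm, $\zeta$ is the Riemann zeta function. For positive integers $d,e$ write $d_e=\frac{d}{(d,e)}$ and $e_d=\frac{e}{(d,e)}$; then $[d_e^{-1}]_{e_d}$ denotes the unique integer $x$ with $0\leq x\leq e_d-1$ such that $d_ex\equiv 1\pmod{e_d}$. For nonzero $P_1,P_2,P_3\in\mathbb{C}[x]$, $m(P_1,P_2,P_3)=\int_0^1\prod_{i=1}^3\log|P_i(e^{2\pi i\theta})|\,d\theta$. *)

theory Defs
  imports
    "HOL-Analysis.Analysis"
    "HOL-Computational_Algebra.Polynomial"
    "HOL-Number_Theory.Cong"
begin

text \<open>
  The Riemann zeta function on the half-line \<open>s > 1\<close>, where it is given by its Dirichlet series.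
\<close>

definition zeta :: "real \<Rightarrow> real" where
  "zeta s = (\<Sum>n. 1 / real (Suc n) powr s)"

definition multiple_mahler :: "complex poly \<Rightarrow> complex poly \<Rightarrow> complex poly \<Rightarrow> real" where
  "multiple_mahler P Q R =
     (LBINT \<theta>:{0..1}.
        ln (cmod (poly P (exp (2 * of_real pi * \<i> * of_real \<theta>)))) *
        ln (cmod (poly Q (exp (2 * of_real pi * \<i> * of_real \<theta>)))) *
        ln (cmod (poly R (exp (2 * of_real pi * \<i> * of_real \<theta>)))))"

definition coprime_part :: "nat \<Rightarrow> nat \<Rightarrow> nat" where
  "coprime_part d e = d div gcd d e"

text \<open>
  For \<open>n = 1\<close> the inverse is \<open>0\<close>.
\<close>

definition inv_mod :: "nat \<Rightarrow> nat \<Rightarrow> int" where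
  "inv_mod u n = (THE x. 0 \<le> x \<and> x \<le> int n - 1 \<and> [int u * x = 1] (mod int n))"

lemma inv_mod_ex1:
  assumes "n > 0" "coprime u n"
  shows "\<exists>!x. 0 \<le> x \<and> x \<le> int n - 1 \<and> [int u * x = 1] (mod int n)"
proof -
  have co: "coprime (int u) (int n)" using assms by simp
  obtain y where y: "[int u * y = 1] (mod int n)"
    using cong_solve_coprime_int[OF co] by blast
  show ?thesis
  proof (rule ex1I[of _ "y mod int n"])
    have "[int u * (y mod int n) = int u * y] (mod int n)"
      by (simp add: cong_def mod_mult_right_eq)
    with y show "0 \<le> y mod int n \<and> y mod int n \<le> int n - 1 \<and>
        [int u * (y mod int n) = 1] (mod int n)"
      using assms by (auto intro: cong_trans)
  next
    fix x assume x: "0 \<le> x \<and> x \<le> int n - 1 \<and> [int u * x = 1] (mod int n)"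
    then have "[int u * x = int u * y] (mod int n)"
      using y cong_sym cong_trans by blast
    then have "[x = y] (mod int n)"
      using co cong_mult_lcancel by blast
    with x show "x = y mod int n" by (simp add: cong_def)
  qed
qed

text \<open>
  The series converges absolutely: the cotangent is finite and periodic in \<open>h\<close> on the index set.
\<close>

definition cot_sum :: "nat \<Rightarrow> nat \<Rightarrow> nat \<Rightarrow> real" where
  "cot_sum d e k =
     (\<Sum>\<^sub>\<infinity>h \<in> {h::nat. h \<ge> 1 \<and> \<not> coprime_part e d dvd k * h}.
        cot (pi * (of_int (inv_mod (coprime_part d e) (coprime_part e d)) * real k * real h)
               / real (coprime_part e d)) / real h ^ 2)"

end

theory Submission
  imports Defs "HOL-Real_Asymp.Real_Asymp"
begin

text \<open>
  Expanding \<open>log |1 - e(t)|\<close> with \<open>e(t) = exp (2 \<pi> i t)\<close> into its Fourier series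
  \<open>- 1/2 \<Sum> e(k t) / |k|\<close> over the nonzero integers \<open>k\<close> turns the integral into \<open>- abc/8\<close> times the sum of
  \<open>1 / |x y z|\<close> over all nonzero integers with \<open>x + y + z = 0\<close>, \<open>a | x\<close>, \<open>b | y\<close>, \<open>c | z\<close>;
  Abel summation makes this rigorous, and since all coefficients are nonnegative the limit \<open>r \<rightarrow> 1\<close>
  also yields convergence of the sum.
  For such triples \<open>1 / |x y z| = - 1 / (x y |z|) - 1 / (y z |x|) - 1 / (z x |y|)\<close>. For fixed
  \<open>z\<close> the sum of \<open>1 / (x y)\<close> runs over an arithmetic progression modulo \<open>lcm a b\<close>, and
  \<open>1 / (x y) = \<plusminus> (1 / x + 1 / y) / z\<close> reduces it to the partial fraction expansion of the cotangent.
  The terms with \<open>x = 0\<close> or \<open>y = 0\<close> that occur in that expansion, but not in the sum over triples,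
  produce the multiples of \<open>zeta 3\<close>.
\<close>

section \<open>Partial fractions of the cotangent\<close>

text \<open>Differentiating both sides of Gamma z * Gamma (1 - z) = pi / sin (pi z) and cancelling
  the nonzero value \<open>G\<close> of the product.\<close>

lemma Digamma_reflection_complex:
  fixes z :: complex
  assumes "z \<notin> \<int>"
  shows "Digamma (1 - z) - Digamma z = of_real pi * cot (of_real pi * z)"
proof -
  have s: "sin (of_real pi * z) \<noteq> 0"
    using assms by (auto simp: sin_eq_0)
  have z1: "z \<notin> \<int>\<^sub>\<le>\<^sub>0" using assms by (auto elim!: nonpos_Ints_cases)
  have z2: "1 - z \<notin> \<int>\<^sub>\<le>\<^sub>0"
  proof
    assume "1 - z \<in> \<int>\<^sub>\<le>\<^sub>0"
    then obtain n where "1 - z = of_int n" by (auto elim!: nonpos_Ints_cases)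
    then have "z = of_int (1 - n)" by (simp add: algebra_simps)
    then show False using assms by auto
  qed
  define G where "G = Gamma z * Gamma (1 - z)"
  have "((\<lambda>w. Gamma w * Gamma (1 - w)) has_field_derivative
      G * (Digamma z - Digamma (1 - z))) (at z)"
    unfolding G_def using z1 z2 by (auto intro!: derivative_eq_intros simp: algebra_simps)
  moreover have "((\<lambda>w. of_real pi / sin (of_real pi * w)) has_field_derivative
      - (of_real pi / sin (of_real pi * z)) * (of_real pi * cot (of_real pi * z))) (at z)"
    using s by (auto intro!: derivative_eq_intros simp: cot_def field_simps)
  ultimately have "G * (Digamma z - Digamma (1 - z)) =
      - (of_real pi / sin (of_real pi * z)) * (of_real pi * cot (of_real pi * z))"
    unfolding Gamma_reflection_complex by (rule DERIV_unique)
  also have "of_real pi / sin (of_real pi * z) = G"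
    by (simp add: G_def Gamma_reflection_complex)
  finally have "G * (Digamma z - Digamma (1 - z)) = G * (- (of_real pi * cot (of_real pi * z)))"
    by simp
  moreover have "G \<noteq> 0" using s by (simp add: G_def Gamma_reflection_complex)
  ultimately have "Digamma z - Digamma (1 - z) = - (of_real pi * cot (of_real pi * z))"
    using mult_left_cancel by blast
  then show ?thesis by (simp add: algebra_simps)
qed

lemma sum_int_Icc_Suc:
  fixes f :: "int \<Rightarrow> 'a::comm_monoid_add"
  shows "(\<Sum>k\<in>{- int (Suc K)..int (Suc K)}. f k) =
    (\<Sum>k\<in>{- int K..int K}. f k) + f (int (Suc K)) + f (- int (Suc K))"
proof -
  have "{- int (Suc K)..int (Suc K)} =
      insert (int (Suc K)) (insert (- int (Suc K)) {- int K..int K})"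
    by auto
  then show ?thesis by (simp add: add_ac)
qed

lemma sum_int_Icc_eq:
  fixes f :: "int \<Rightarrow> 'a::comm_monoid_add"
  shows "(\<Sum>k\<in>{- int K..int K}. f k) = f 0 + (\<Sum>n<K. f (int (Suc n)) + f (- int (Suc n)))"
  by (induction K) (simp_all only: sum_int_Icc_Suc, simp_all add: add_ac)

text \<open>Moving the window by one affects only the two boundary terms; this carries the limit in
  the cotangent expansion from one integer to the next.\<close>

lemma sum_int_Icc_shift:
  fixes f :: "int \<Rightarrow> 'a::ab_group_add"
  shows "(\<Sum>k\<in>{- int K..int K}. f (k + 1)) =
    (\<Sum>k\<in>{- int K..int K}. f k) + f (int K + 1) - f (- int K)"
  by (induction K) (simp_all only: sum_int_Icc_Suc, simp_all add: algebra_simps)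

lemma tendsto_inverse_add_of_nat: "(\<lambda>K. 1 / (u + real K)) \<longlonglongrightarrow> 0"
  by real_asymp

lemma tendsto_inverse_diff_of_nat: "(\<lambda>K. 1 / (u - real K)) \<longlonglongrightarrow> 0"
  by real_asymp

text \<open>The nonzero factor cos (pi n) cancels. At a pole both sides are \<open>0\<close> by
  division by zero; in particular cot (pi n) = 0 for every integer n.\<close>

lemma cot_add_pi_of_int: "cot (x + pi * of_int n) = cot (x::real)"
proof -
  have "sin (pi * of_int n) = 0" by (auto simp: sin_zero_iff_int2)
  moreover from this have "cos (pi * of_int n) \<noteq> 0"
    using sin_cos_squared_add[of "pi * of_int n"] by auto
  ultimately show ?thesis by (simp add: cot_def sin_add cos_add)
qed

text \<open>Since \<open>x / 0 = 0\<close>, this also holds for integral \<open>u\<close>, where both sides drop the pole.\<close>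

lemma cot_partial_fractions:
  fixes u :: real
  shows "(\<lambda>K. \<Sum>k\<in>{- int K..int K}. 1 / (u + of_int k)) \<longlonglongrightarrow> pi * cot (pi * u)"
proof (cases "u \<in> \<int>")
  case False
  define z :: complex where "z = of_real u"
  have z: "z \<notin> \<int>" using False by (metis Ints_cases Ints_of_int of_real_eq_iff of_real_of_int_eq z_def)
  then have z0: "z \<noteq> 0" "1 - z \<noteq> 0" by auto
  \<comment> \<open>The logarithms in the two limits for \<open>Digamma\<close> cancel, which leaves
    a difference of two sums of reciprocals.\<close>
  have "(\<lambda>m. (of_real (ln (real m)) - (\<Sum>n<m. inverse (1 - z + of_nat n))) -
             (of_real (ln (real m)) - (\<Sum>n<m. inverse (z + of_nat n))))
        \<longlonglongrightarrow> Digamma (1 - z) - Digamma z"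
    by (intro tendsto_diff Digamma_LIMSEQ z0)
  also have "Digamma (1 - z) - Digamma z = of_real (pi * cot (pi * u))"
    using Digamma_reflection_complex[OF z] by (simp add: z_def cot_of_real)
  also have "(\<lambda>m. (of_real (ln (real m)) - (\<Sum>n<m. inverse (1 - z + of_nat n))) -
             (of_real (ln (real m)) - (\<Sum>n<m. inverse (z + of_nat n)))) =
     (\<lambda>m. of_real ((\<Sum>n<m. inverse (u + real n)) - (\<Sum>n<m. inverse (1 - u + real n))))"
    by (simp add: z_def)
  finally have "(\<lambda>m. (\<Sum>n<m. inverse (u + real n)) - (\<Sum>n<m. inverse (1 - u + real n)))
      \<longlonglongrightarrow> pi * cot (pi * u)"
    by (subst (asm) tendsto_of_real_iff)
  \<comment> \<open>The first sum covers k = 0, ..., m - 1 and the second k = -1, ..., -m; the added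
    null sequence supplies the missing end k = m.\<close>
  from tendsto_add[OF this tendsto_inverse_add_of_nat[of u]]
  have "(\<lambda>m. (\<Sum>n<m. inverse (u + real n)) - (\<Sum>n<m. inverse (1 - u + real n)) + 1 / (u + real m))
      \<longlonglongrightarrow> pi * cot (pi * u)" by simp
  also have "(\<lambda>m. (\<Sum>n<m. inverse (u + real n)) - (\<Sum>n<m. inverse (1 - u + real n)) + 1 / (u + real m))
      = (\<lambda>K. \<Sum>k\<in>{- int K..int K}. 1 / (u + of_int k))"
  proof
    fix K
    have inv: "inverse (1 - u + real n) = - (1 / (u - 1 - real n))" for n
      by (metis (no_types, opaque_lifting) add_diff_eq diff_diff_eq2 divide_inverse inverse_minus_eq
          minus_diff_eq mult.left_neutral add.commute diff_diff_eq add_uminus_conv_diff)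
    show "(\<Sum>n<K. inverse (u + real n)) - (\<Sum>n<K. inverse (1 - u + real n)) + 1 / (u + real K) =
      (\<Sum>k\<in>{- int K..int K}. 1 / (u + of_int k))"
    proof (induction K)
      case (Suc K)
      then show ?case
        unfolding sum_int_Icc_Suc by (simp add: inv) (simp add: divide_inverse algebra_simps)
    qed simp
  qed
  finally show ?thesis .
next
  case True
  \<comment> \<open>For n = 0 the terms at k and -k cancel and the term at k = 0 is 1/0 = 0. Each
    step in either direction changes the sum by two boundary terms that tend to 0.\<close>
  have zero: "(\<lambda>K. \<Sum>k\<in>{- int K..int K}. 1 / (of_int n + of_int k :: real)) \<longlonglongrightarrow> 0" for n
  proof (induction n rule: int_induct[where k = 0])
    case base
    have "1 / (- 1 - real n) = - (1 / (1 + real n))" for n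
      by (simp add: divide_simps)
    then show ?case by (simp add: sum_int_Icc_eq)
  next
    case (step1 n)
    have eq: "(\<Sum>k\<in>{- int K..int K}. 1 / (of_int (n + 1) + of_int k :: real)) =
        (\<Sum>k\<in>{- int K..int K}. 1 / (of_int n + of_int k)) + 1 / (of_int n + 1 + real K)
          - 1 / (of_int n - real K)" for K
      using sum_int_Icc_shift[of "\<lambda>k. 1 / (of_int n + of_int k :: real)" K]
      by (simp add: add_ac)
    show ?case unfolding eq
      using tendsto_diff[OF tendsto_add[OF step1(2) tendsto_inverse_add_of_nat[of "of_int n + 1"]]
          tendsto_inverse_diff_of_nat[of "of_int n"]] by simp
  next
    case (step2 n)
    have eq: "(\<Sum>k\<in>{- int K..int K}. 1 / (of_int (n - 1) + of_int k :: real)) =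
        (\<Sum>k\<in>{- int K..int K}. 1 / (of_int n + of_int k)) - 1 / (of_int n + real K)
          + 1 / (of_int n - 1 - real K)" for K
      using sum_int_Icc_shift[of "\<lambda>k. 1 / (of_int (n - 1) + of_int k :: real)" K]
      by (simp add: add_ac)
    show ?case unfolding eq
      using tendsto_add[OF tendsto_diff[OF step2(2) tendsto_inverse_add_of_nat[of "of_int n"]]
          tendsto_inverse_diff_of_nat[of "of_int n - 1"]] by simp
  qed
  from True obtain n where n: "u = of_int n" by (auto elim: Ints_cases)
  have "cot (pi * u) = 0" using cot_add_pi_of_int[of 0 n] by (simp add: n)
  then show ?thesis using zero[of n] by (simp add: n)
qed

text \<open>The intervals from -K to K are cofinal among the finite sets of integers. This makes the
  symmetric limit of the cotangent expansion usable for unordered sums.\<close>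

lemma summable_on_int_tendsto_symmetric:
  fixes f :: "int \<Rightarrow> real"
  assumes "f summable_on UNIV"
  shows "(\<lambda>K. \<Sum>k\<in>{- int K..int K}. f k) \<longlonglongrightarrow> infsum f UNIV"
proof -
  have "filterlim (\<lambda>K. {- int K..int K}) (finite_subsets_at_top UNIV) sequentially"
    unfolding filterlim_finite_subsets_at_top
  proof safe
    fix X :: "int set" assume X: "finite X"
    define N where "N = Max (insert 0 ((\<lambda>x. nat \<bar>x\<bar>) ` X))"
    have N: "\<bar>x\<bar> \<le> int N" if "x \<in> X" for x
    proof -
      have "nat \<bar>x\<bar> \<le> N" unfolding N_def using X that by (intro Max_ge) auto
      then show ?thesis by simp
    qed
    show "\<forall>\<^sub>F K in sequentially. finite {- int K..int K} \<and> X \<subseteq> {- int K..int K} \<and> {- int K..int K} \<subseteq> UNIV"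
      using eventually_ge_at_top[of N] by eventually_elim (use N in fastforce)
  qed
  with has_sum_infsum[OF assms] show ?thesis
    unfolding has_sum_def by (rule filterlim_compose)
qed

text \<open>For X = u + k and Y = v - k one has 1 / (X Y) = (1 / X + 1 / Y) / (u + v), and both
  parts are cotangent expansions. Where X or Y is 0, the left side is 0 by division by zero but the
  right side is 1 / (u + v)^2; such k exist only for integral u or v, which gives the subtracted
  term.\<close>

lemma infsum_cot:
  fixes u v :: real
  assumes uv: "u + v \<noteq> 0"
    and summ: "(\<lambda>k::int. 1 / ((u + of_int k) * (v - of_int k))) summable_on UNIV"
  shows "(\<Sum>\<^sub>\<infinity>k::int. 1 / ((u + of_int k) * (v - of_int k))) =
    pi * (cot (pi * u) + cot (pi * v)) / (u + v) - (of_bool (u \<in> \<int>) + of_bool (v \<in> \<int>)) / (u + v)\<^sup>2"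
    (is "infsum ?f UNIV = _")
proof -
  let ?e = "\<lambda>k::int. of_bool (u = - of_int k) + of_bool (v = of_int k) :: real"
  have ptw: "?f k = (1 / (u + of_int k) + 1 / (v - of_int k)) / (u + v) - ?e k / (u + v)\<^sup>2" for k
  proof (cases "u = - of_int k")
    case True
    then show ?thesis using uv by (auto simp: power2_eq_square)
  next
    case u: False
    show ?thesis
    proof (cases "v = of_int k")
      case True
      then show ?thesis using u uv by (auto simp: power2_eq_square)
    next
      case False
      then have "u + of_int k \<noteq> 0" "v - of_int k \<noteq> 0" using u by auto
      then have "1 / (u + of_int k) + 1 / (v - of_int k) = (u + v) * ?f k"
        by (simp add: field_simps)
      then show ?thesis using u False uv by simp
    qed
  qed
  have "(\<lambda>K. (\<Sum>k\<in>{- int K..int K}. 1 / (v + of_int k))) \<longlonglongrightarrow> pi * cot (pi * v)"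
    by (rule cot_partial_fractions)
  moreover have "(\<Sum>k\<in>{- int K..int K}. 1 / (v + of_int k)) = (\<Sum>k\<in>{- int K..int K}. 1 / (v - of_int k))" for K
    by (rule sum.reindex_bij_witness[of _ uminus uminus]) auto
  ultimately have v: "(\<lambda>K. (\<Sum>k\<in>{- int K..int K}. 1 / (v - of_int k))) \<longlonglongrightarrow> pi * cot (pi * v)"
    by simp
  have e1: "(\<lambda>K. \<Sum>k\<in>{- int K..int K}. of_bool (w = of_int k) :: real) \<longlonglongrightarrow> of_bool (w \<in> \<int>)" for w :: real
  proof (rule tendsto_eventually, cases "w \<in> \<int>")
    case True
    then obtain n where n: "w = of_int n" by (auto elim: Ints_cases)
    show "\<forall>\<^sub>F K in sequentially. (\<Sum>k\<in>{- int K..int K}. of_bool (w = of_int k) :: real) = of_bool (w \<in> \<int>)"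
      using eventually_ge_at_top[of "nat \<bar>n\<bar>"]
    proof eventually_elim
      case (elim K)
      have "(\<Sum>k\<in>{- int K..int K}. of_bool (w = of_int k) :: real) = (\<Sum>k\<in>{n}. 1)"
        by (rule sum.mono_neutral_cong_right) (use elim in \<open>auto simp: n\<close>)
      then show ?case by (simp add: n)
    qed
  qed (auto intro!: always_eventually sum.neutral)
  have e2: "(\<lambda>K. \<Sum>k\<in>{- int K..int K}. of_bool (u = - of_int k) :: real) \<longlonglongrightarrow> of_bool (u \<in> \<int>)"
  proof -
    have "(\<Sum>k\<in>{- int K..int K}. of_bool (u = - of_int k) :: real) =
        (\<Sum>k\<in>{- int K..int K}. of_bool (u = of_int k))" for K
      by (rule sum.reindex_bij_witness[of _ uminus uminus]) auto
    then show ?thesis using e1[of u] by simp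
  qed
  have "(\<lambda>K. ((\<Sum>k\<in>{- int K..int K}. 1 / (u + of_int k)) + (\<Sum>k\<in>{- int K..int K}. 1 / (v - of_int k))) / (u + v)
      - ((\<Sum>k\<in>{- int K..int K}. of_bool (u = - of_int k)) + (\<Sum>k\<in>{- int K..int K}. of_bool (v = of_int k))) / (u + v)\<^sup>2)
     \<longlonglongrightarrow> (pi * cot (pi * u) + pi * cot (pi * v)) / (u + v) -
         (of_bool (u \<in> \<int>) + of_bool (v \<in> \<int>)) / (u + v)\<^sup>2"
    by (intro tendsto_intros cot_partial_fractions v e1 e2) (use uv in auto)
  also have "(\<lambda>K. ((\<Sum>k\<in>{- int K..int K}. 1 / (u + of_int k)) + (\<Sum>k\<in>{- int K..int K}. 1 / (v - of_int k))) / (u + v)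
      - ((\<Sum>k\<in>{- int K..int K}. of_bool (u = - of_int k)) + (\<Sum>k\<in>{- int K..int K}. of_bool (v = of_int k))) / (u + v)\<^sup>2)
    = (\<lambda>K. \<Sum>k\<in>{- int K..int K}. ?f k)"
    unfolding ptw by (simp only: sum_subtractf sum.distrib flip: sum_divide_distrib)
  finally have "(\<lambda>K. \<Sum>k\<in>{- int K..int K}. ?f k) \<longlonglongrightarrow> (pi * cot (pi * u) + pi * cot (pi * v)) / (u + v) -
         (of_bool (u \<in> \<int>) + of_bool (v \<in> \<int>)) / (u + v)\<^sup>2" .
  with summable_on_int_tendsto_symmetric[OF summ]
  show ?thesis by (auto dest: LIMSEQ_unique simp: algebra_simps)
qed

section \<open>Reciprocal products over a residue class\<close>

text \<open>Once a solution \<open>p\<close> is known, this turns the two divisibility conditions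
  into a single residue class modulo the lcm, which an integer index can enumerate.\<close>

lemma dvd_diff_lcm_iff:
  fixes a b z p x :: int
  assumes "a dvd p" "b dvd z - p"
  shows "a dvd x \<and> b dvd z - x \<longleftrightarrow> lcm a b dvd x - p"
proof
  assume x: "a dvd x \<and> b dvd z - x"
  have "a dvd x - p" using x assms by (auto intro: dvd_diff)
  moreover have "b dvd (z - p) - (z - x)" using x assms(2) dvd_diff by blast
  ultimately show "lcm a b dvd x - p" by auto
next
  assume "lcm a b dvd x - p"
  then have "a dvd x - p" "b dvd x - p" by auto
  then have "a dvd (x - p) + p" "b dvd (z - p) - (x - p)"
    using assms by (simp_all only: dvd_add dvd_diff)
  then show "a dvd x \<and> b dvd z - x" by auto
qed

lemma of_int_divide_mem_Ints_iff:
  assumes "M \<noteq> 0"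
  shows "real_of_int p / real_of_int M \<in> \<int> \<longleftrightarrow> M dvd p"
proof
  assume "real_of_int p / real_of_int M \<in> \<int>"
  then obtain n where "real_of_int p / real_of_int M = of_int n" by (auto elim: Ints_cases)
  then have "real_of_int p = of_int (M * n)" using assms by (simp add: field_simps)
  then show "M dvd p" by (simp only: of_int_eq_iff) simp
qed (use assms in auto)

text \<open>Writing x = p + M k with M = lcm a b turns the sum into that of
  \<open>infsum_cot\<close>, with u = p / M, v = (z - p) / M and a factor 1 / M^2. The residue
  \<open>q\<close>, the analogue of \<open>p\<close> with a and b exchanged, replaces z - p so that
  the two cotangents have symmetric form.\<close>

lemma infsum_complementary_multiples:
  fixes a b z p q :: int
  assumes ab: "a > 0" "b > 0" and z: "z \<noteq> 0"
    and p: "a dvd p" "b dvd z - p" and q: "b dvd q" "a dvd z - q"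
    and summ: "(\<lambda>x. 1 / (of_int x * of_int (z - x)) :: real) summable_on {x. a dvd x \<and> b dvd z - x}"
  shows "(\<Sum>\<^sub>\<infinity>x\<in>{x. a dvd x \<and> b dvd z - x}. 1 / (of_int x * of_int (z - x)) :: real) =
    pi * (cot (pi * of_int p / of_int (lcm a b)) + cot (pi * of_int q / of_int (lcm a b))) / (of_int (lcm a b) * of_int z)
    - (of_bool (a dvd z) + of_bool (b dvd z)) / (of_int z)\<^sup>2"
proof -
  define M where "M = lcm a b"
  have M: "M > 0" using ab by (simp add: M_def lcm_pos_int)
  have X: "x \<in> {x. a dvd x \<and> b dvd z - x} \<longleftrightarrow> M dvd x - p" for x
    using dvd_diff_lcm_iff[OF p] by (simp add: M_def)
  define u v :: real where "u = of_int p / of_int M" and "v = of_int (z - p) / of_int M"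
  have uv: "u + v = of_int z / of_int M" using M by (simp add: u_def v_def field_simps)
  let ?f = "\<lambda>x::int. 1 / (of_int x * of_int (z - x)) :: real"
  let ?g = "\<lambda>k::int. 1 / ((u + of_int k) * (v - of_int k))"
  have bij: "bij_betw (\<lambda>k. p + M * k) UNIV {x. a dvd x \<and> b dvd z - x}"
  proof (rule bij_betwI[where g = "\<lambda>x. (x - p) div M"])
    show "(\<lambda>k. p + M * k) \<in> UNIV \<rightarrow> {x. a dvd x \<and> b dvd z - x}"
      by (simp only: Pi_iff X) simp
  next
    fix x assume "x \<in> {x. a dvd x \<and> b dvd z - x}"
    then have "M dvd x - p" by (simp only: X)
    then show "p + M * ((x - p) div M) = x" by simp
  qed (use M in auto)
  have fg: "?f (p + M * k) = ?g k / (of_int M)\<^sup>2" for k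
  proof -
    have "of_int (p + M * k) = of_int M * (u + of_int k)"
         "of_int (z - (p + M * k)) = of_int M * (v - of_int k)"
      using M by (simp_all add: u_def v_def field_simps)
    then show ?thesis by (simp add: power2_eq_square mult_ac)
  qed
  have "(\<lambda>k. ?f (p + M * k)) summable_on UNIV"
    using summ summable_on_reindex_bij_betw[OF bij, of ?f] by simp
  then have "(\<lambda>k. ?g k / (of_int M)\<^sup>2) summable_on UNIV" by (simp only: fg)
  then have summ': "?g summable_on UNIV"
    using summable_on_cmult_right[of "\<lambda>k. ?g k / (of_int M)\<^sup>2" UNIV "(of_int M)\<^sup>2"] M by simp
  have "infsum ?f {x. a dvd x \<and> b dvd z - x} = (\<Sum>\<^sub>\<infinity>k. ?f (p + M * k))"
    using infsum_reindex_bij_betw[OF bij, of ?f] by simp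
  also have "\<dots> = (\<Sum>\<^sub>\<infinity>k. ?g k * (1 / (of_int M)\<^sup>2))" by (simp only: fg) simp
  also have "\<dots> = infsum ?g UNIV * (1 / (of_int M)\<^sup>2)" by (rule infsum_cmult_left')
  also have "infsum ?g UNIV = pi * (cot (pi * u) + cot (pi * v)) / (u + v)
      - (of_bool (u \<in> \<int>) + of_bool (v \<in> \<int>)) / (u + v)\<^sup>2"
    by (rule infsum_cot) (use uv z M summ' in auto)
  \<comment> \<open>u is integral exactly if x = 0 lies in the residue class; likewise v below, with
    x = z.\<close>
  also have "u \<in> \<int> \<longleftrightarrow> b dvd z"
  proof -
    have "u \<in> \<int> \<longleftrightarrow> M dvd 0 - p" using M by (simp add: u_def of_int_divide_mem_Ints_iff)
    also have "\<dots> \<longleftrightarrow> b dvd z" using X[of 0] by simp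
    finally show ?thesis .
  qed
  also have "v \<in> \<int> \<longleftrightarrow> a dvd z"
  proof -
    have "v \<in> \<int> \<longleftrightarrow> M dvd z - p" using M unfolding v_def by (simp add: of_int_divide_mem_Ints_iff del: of_int_diff)
    also have "\<dots> \<longleftrightarrow> a dvd z" using X[of z] by simp
    finally show ?thesis .
  qed
  \<comment> \<open>z - q satisfies the same divisibilities as p, so the two are congruent modulo M
    and the period pi of the cotangent applies.\<close>
  also have "cot (pi * v) = cot (pi * of_int q / of_int M)"
  proof -
    have "M dvd z - q - p" using X[of "z - q"] q by simp
    then obtain n where n: "z - q - p = M * n" by blast
    then have "z - p = q + M * n" by simp
    then have "pi * v = pi * of_int q / of_int M + pi * of_int n"
      using M unfolding v_def by (simp add: field_simps)
    then show ?thesis by (simp only: cot_add_pi_of_int)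
  qed
  also have "pi * u = pi * of_int p / of_int M" by (simp add: u_def)
  also have "(pi * C / (u + v) - D / (u + v)\<^sup>2) * (1 / (of_int M)\<^sup>2) =
      pi * C / (of_int M * of_int z) - D / (of_int z)\<^sup>2" for C D
    using M z unfolding uv by (simp add: field_simps power2_eq_square)
  finally show ?thesis unfolding M_def by (simp only: add.commute)
qed

section \<open>Signed sums over zero-sum triples\<close>

text \<open>Used to fold a sum over all multiples z onto z > 0, the range of \<open>cot_sum\<close>
  and \<open>zeta\<close>; the symmetric partial sums pair k with -k.\<close>

lemma even_has_sum_nat:
  fixes f :: "int \<Rightarrow> real"
  assumes summ: "f summable_on UNIV" and even: "\<And>k. f (- k) = f k" and f0: "f 0 = 0"
  shows "((\<lambda>n. f (int (Suc n))) has_sum (infsum f UNIV / 2)) UNIV"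
proof -
  have inj: "inj (\<lambda>n. int (Suc n))" by (auto simp: inj_on_def)
  have "f summable_on range (\<lambda>n. int (Suc n))" by (rule summable_on_subset[OF summ]) auto
  then have s: "(\<lambda>n. f (int (Suc n))) summable_on UNIV"
    using summable_on_reindex[OF inj, of f] by (simp add: o_def)
  then have "(\<lambda>n. f (int (Suc n))) sums (\<Sum>\<^sub>\<infinity>n. f (int (Suc n)))"
    by (intro has_sum_imp_sums has_sum_infsum)
  then have "(\<lambda>K. 2 * (\<Sum>n<K. f (int (Suc n)))) \<longlonglongrightarrow> 2 * (\<Sum>\<^sub>\<infinity>n. f (int (Suc n)))"
    unfolding sums_def by (intro tendsto_intros)
  moreover have "(\<lambda>K. 2 * (\<Sum>n<K. f (int (Suc n)))) \<longlonglongrightarrow> infsum f UNIV"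
    using summable_on_int_tendsto_symmetric[OF summ]
    by (simp add: sum_int_Icc_eq f0 even sum_distrib_left flip: mult_2 del: of_nat_Suc)
  ultimately have "2 * (\<Sum>\<^sub>\<infinity>n. f (int (Suc n))) = infsum f UNIV" by (rule LIMSEQ_unique)
  then have "(\<Sum>\<^sub>\<infinity>n. f (int (Suc n))) = infsum f UNIV / 2" by simp
  then show ?thesis using has_sum_infsum[OF s] by (simp only:)
qed

lemma zeta_3_has_sum: "((\<lambda>n. 1 / real (Suc n) ^ 3) has_sum zeta 3) UNIV"
proof -
  have "summable (\<lambda>n. 1 / real (Suc n) ^ 3)"
    using inverse_power_summable[of 3, where 'a = real] summable_Suc_iff[of "\<lambda>n. inverse (real n ^ 3)"]
    by (simp add: inverse_eq_divide)
  then have "(\<lambda>n. 1 / real (Suc n) ^ 3) sums (\<Sum>n. 1 / real (Suc n) ^ 3)" by (rule summable_sums)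
  then have "((\<lambda>n. 1 / real (Suc n) ^ 3) has_sum (\<Sum>n. 1 / real (Suc n) ^ 3)) UNIV"
    by (rule sums_nonneg_imp_has_sum) auto
  moreover have "real (Suc n) powr 3 = real (Suc n) ^ 3" for n
    by (subst powr_numeral) auto
  ultimately show ?thesis by (simp add: zeta_def)
qed

text \<open>With l = d e, the indicator keeps exactly those n with e | n + 1; setting n + 1 = e (m +
  1) turns the terms into 1 / (l (m + 1))^3.\<close>

lemma zeta_3_multiples_has_sum:
  fixes d l :: nat
  assumes "d > 0" "l > 0" "d dvd l"
  shows "((\<lambda>n. of_bool (l dvd d * Suc n) / real (d * Suc n) ^ 3) has_sum (zeta 3 / real l ^ 3)) UNIV"
proof -
  obtain e where l: "l = d * e" using assms by blast
  then have e: "e > 0" using assms by simp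
  have bij: "bij_betw (\<lambda>m. e * Suc m - 1) UNIV {n. e dvd Suc n}"
  proof (rule bij_betwI[where g = "\<lambda>n. Suc n div e - 1"])
    show "(\<lambda>m. e * Suc m - 1) \<in> UNIV \<rightarrow> {n. e dvd Suc n}" using e by (auto simp: Suc_diff_1)
    show "(\<lambda>n. Suc n div e - 1) \<in> {n. e dvd Suc n} \<rightarrow> UNIV" by simp
    fix m show "Suc (e * Suc m - 1) div e - 1 = m" using e by simp
  next
    fix n assume "n \<in> {n. e dvd Suc n}"
    then obtain k where k: "Suc n = e * k" by blast
    then have "k > 0" by (cases k) auto
    with k e show "e * Suc (Suc n div e - 1) - 1 = n"
      by (metis Suc_diff_1 diff_Suc_1 nonzero_mult_div_cancel_left not_gr_zero)
  qed
  have "((\<lambda>m. 1 / real l ^ 3 * (1 / real (Suc m) ^ 3)) has_sum (1 / real l ^ 3 * zeta 3)) UNIV"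
    by (intro has_sum_cmult_right zeta_3_has_sum)
  moreover have "1 / real l ^ 3 * (1 / real (Suc m) ^ 3) = 1 / real (d * Suc (e * Suc m - 1)) ^ 3" for m
  proof -
    have "Suc (e * Suc m - 1) = e * Suc m" using e by simp
    then have "real (d * Suc (e * Suc m - 1)) = real l * real (Suc m)"
      by (simp only: l of_nat_mult mult.assoc)
    then show ?thesis by (simp only: power_mult_distrib) simp
  qed
  ultimately have "((\<lambda>m. 1 / real (d * Suc (e * Suc m - 1)) ^ 3) has_sum (zeta 3 / real l ^ 3)) UNIV"
    by simp
  then have "((\<lambda>n. 1 / real (d * Suc n) ^ 3) has_sum (zeta 3 / real l ^ 3)) {n. e dvd Suc n}"
    using has_sum_reindex_bij_betw[OF bij, of "\<lambda>n. 1 / real (d * Suc n) ^ 3"] by simp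
  also have "?this \<longleftrightarrow> ?thesis"
    using assms by (intro has_sum_cong_neutral) (auto simp: l simp del: mult_Suc_right)
  finally show ?thesis .
qed

text \<open>By periodicity only the residue of i modulo n matters, so the sum of the finitely many
  absolute values serves as a crude bound.\<close>

lemma bounded_cot_rational:
  fixes n :: nat
  assumes "n > 0"
  obtains B where "\<And>i::int. \<bar>cot (pi * of_int i / real n)\<bar> \<le> B"
proof
  fix i :: int
  define j where "j = i mod int n"
  have j: "j \<in> {0..<int n}" using assms by (simp add: j_def)
  have "i = j + int n * (i div int n)" by (simp add: j_def)
  then have "of_int i = (of_int j + real n * of_int (i div int n) :: real)"
    by (metis of_int_add of_int_mult of_int_of_nat_eq)
  then have "pi * of_int i / real n = pi * of_int j / real n + pi * of_int (i div int n)"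
    using assms by (simp add: field_simps)
  then have "cot (pi * of_int i / real n) = cot (pi * of_int j / real n)"
    by (simp only: cot_add_pi_of_int)
  also have "\<bar>\<dots>\<bar> \<le> (\<Sum>j\<in>{0..<int n}. \<bar>cot (pi * of_int j / real n)\<bar>)"
    using j by (intro member_le_sum) auto
  finally show "\<bar>cot (pi * of_int i / real n)\<bar> \<le> (\<Sum>j\<in>{0..<int n}. \<bar>cot (pi * of_int j / real n)\<bar>)" .
qed

lemma coprime_part_mult: "coprime_part d e * gcd d e = d"
  by (simp add: coprime_part_def)

lemma coprime_part_pos: "d > 0 \<Longrightarrow> coprime_part d e > 0"
  by (metis coprime_part_mult gr0I mult_zero_left less_irrefl)

lemma inv_mod_cong:
  assumes "d > 0" "e > 0"
  shows "[int (coprime_part d e) * inv_mod (coprime_part d e) (coprime_part e d) = 1]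
    (mod int (coprime_part e d))"
proof -
  have "coprime (coprime_part d e) (coprime_part e d)"
    using assms div_gcd_coprime[of d e] by (simp add: coprime_part_def gcd.commute)
  from theI'[OF inv_mod_ex1[OF coprime_part_pos[OF assms(2)] this]] show ?thesis
    unfolding inv_mod_def by blast
qed

text \<open>The excluded h contribute nothing, because there the argument is an integral multiple of
  pi and \<open>cot\<close> takes the value 0; so the sum may run over all h = n + 1. Summability
  comes from comparison with a multiple of 1 / h^2.\<close>

lemma cot_sum_has_sum:
  assumes "e > 0"
  shows "((\<lambda>n. cot (pi * (of_int (inv_mod (coprime_part d e) (coprime_part e d)) * real k * real (Suc n))
     / real (coprime_part e d)) / real (Suc n) ^ 2) has_sum cot_sum d e k) UNIV"
proof -
  define E where "E = coprime_part e d"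
  define v where "v = inv_mod (coprime_part d e) E"
  have E: "E > 0" using assms by (simp add: E_def coprime_part_pos)
  define f where "f h = cot (pi * (of_int v * real k * real h) / real E) / real h ^ 2" for h :: nat
  obtain B where B: "\<And>i::int. \<bar>cot (pi * of_int i / real E)\<bar> \<le> B"
    using bounded_cot_rational[OF E] by blast
  have Bn: "\<bar>cot (pi * (of_int v * real k * real h) / real E)\<bar> \<le> B" for h
    using B[of "v * int k * int h"] by simp
  have "summable (\<lambda>n. 1 / real (Suc n) ^ 2)"
    using inverse_power_summable[of 2, where 'a = real] summable_Suc_iff[of "\<lambda>n. inverse (real n ^ 2)"]
    by (simp add: inverse_eq_divide)
  then have "summable (\<lambda>n. B * (1 / real (Suc n) ^ 2))" by (rule summable_mult)
  then have "summable (\<lambda>n. norm (f (Suc n)))"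
    by (rule summable_comparison_test'[of _ 0])
      (use Bn in \<open>auto simp: f_def abs_mult simp del: of_nat_Suc intro!: divide_right_mono\<close>)
  then have s: "(\<lambda>n. f (Suc n)) summable_on UNIV" by (rule norm_summable_imp_summable_on)
  have z: "f h = 0" if "E dvd k * h" for h
  proof -
    from that obtain t where "k * h = E * t" by blast
    then have "real k * real h = real E * real t" by (metis of_nat_mult)
    then have "of_int v * real k * real h = real E * (of_int v * real t)"
      by (simp only: mult.assoc mult.left_commute)
    then have "pi * (of_int v * real k * real h) / real E = 0 + pi * of_int (v * int t)"
      using E by (simp only:) simp
    then have "cot (pi * (of_int v * real k * real h) / real E) = 0"
      by (simp only: cot_add_pi_of_int cot_zero)
    then show ?thesis by (simp add: f_def)
  qed
  have "cot_sum d e k = infsum f {h. h \<ge> 1 \<and> \<not> E dvd k * h}"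
    unfolding cot_sum_def E_def[symmetric] by (intro infsum_cong) (simp add: f_def v_def)
  also have "\<dots> = infsum f (range Suc)"
    by (rule infsum_cong_neutral) (use z in \<open>auto simp: image_iff dest: Suc_le_D\<close>)
  also have "\<dots> = (\<Sum>\<^sub>\<infinity>n. f (Suc n))" by (subst infsum_reindex) (auto simp: o_def)
  finally show ?thesis using has_sum_infsum[OF s] by (simp add: f_def E_def v_def)
qed

text \<open>Zero entries are allowed: their terms vanish in all sums below because \<open>1 / 0 = 0\<close>.\<close>

definition zero_sum_triples :: "nat \<Rightarrow> nat \<Rightarrow> nat \<Rightarrow> (int \<times> int \<times> int) set" where
  "zero_sum_triples a b c = {(x, y, z). int a dvd x \<and> int b dvd y \<and> int c dvd z \<and> x + y + z = 0}"

section \<open>Triples with a distinguished entry\<close>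

text \<open>Supplies explicit residues for \<open>infsum_complementary_multiples\<close>. Division
  of \<open>p\<close> by lcm a b = a * coprime_part b a produces exactly the cotangent arguments of
  \<open>cot_sum\<close>, and \<open>q\<close> does the same with a and b exchanged.\<close>

lemma complementary_multiples_sum:
  fixes a b c h :: nat
  assumes pos: "a > 0" "b > 0" "c > 0" "h > 0"
  defines "z \<equiv> int (c * gcd a b * h)"
  assumes summ: "(\<lambda>x. 1 / (of_int x * of_int (z - x)) :: real) summable_on {x. int a dvd x \<and> int b dvd z - x}"
  shows "(\<Sum>\<^sub>\<infinity>x\<in>{x. int a dvd x \<and> int b dvd z - x}. 1 / (of_int x * of_int (z - x)) :: real) =
    pi * (cot (pi * (of_int (inv_mod (coprime_part a b) (coprime_part b a)) * real c * real h) / real (coprime_part b a))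
        + cot (pi * (of_int (inv_mod (coprime_part b a) (coprime_part a b)) * real c * real h) / real (coprime_part a b)))
      / (real (lcm a b) * of_int z)
    - (of_bool (a dvd c * gcd a b * h) + of_bool (b dvd c * gcd a b * h)) / (of_int z)\<^sup>2"
proof -
  define p q where "p = int a * inv_mod (coprime_part a b) (coprime_part b a) * int (c * h)"
    and "q = int b * inv_mod (coprime_part b a) (coprime_part a b) * int (c * h)"
  \<comment> \<open>Multiplying d_e [d_e^-1] = 1 modulo e_d by gcd d e lifts it to d [d_e^-1] = gcd
    d e modulo e; a further factor c h reaches z.\<close>
  have *: "int e dvd int (c * gcd d e * h) - int d * inv_mod (coprime_part d e) (coprime_part e d) * int (c * h)"
    if "d > 0" "e > 0" for d e
  proof -
    have "int (coprime_part e d) dvd 1 - int (coprime_part d e) * inv_mod (coprime_part d e) (coprime_part e d)"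
      using inv_mod_cong[OF that] by (simp add: cong_iff_dvd_diff dvd_diff_commute)
    then have "int (coprime_part e d) * int (gcd d e) dvd
        (1 - int (coprime_part d e) * inv_mod (coprime_part d e) (coprime_part e d)) * int (gcd d e)"
      by (rule mult_dvd_mono) simp
    also have "int (coprime_part e d) * int (gcd d e) = int e"
      by (metis coprime_part_mult gcd.commute of_nat_mult)
    also have "(1 - int (coprime_part d e) * inv_mod (coprime_part d e) (coprime_part e d)) * int (gcd d e)
      = int (gcd d e) - int (coprime_part d e * gcd d e) * inv_mod (coprime_part d e) (coprime_part e d)"
      by (simp add: algebra_simps)
    also have "coprime_part d e * gcd d e = d" by (rule coprime_part_mult)
    finally have "int e dvd (int (gcd d e) - int d * inv_mod (coprime_part d e) (coprime_part e d)) * int (c * h)"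
      by (rule dvd_mult2)
    then show ?thesis by (simp add: algebra_simps)
  qed
  have p: "int a dvd p" "int b dvd z - p" using *[of a b] pos by (simp_all add: p_def z_def mult.assoc)
  have q: "int b dvd q" "int a dvd z - q"
    using *[of b a] pos by (simp_all add: q_def z_def mult.assoc gcd.commute)
  have z: "z \<noteq> 0" using pos by (simp add: z_def)
  have L: "a * coprime_part b a = lcm a b" "b * coprime_part a b = lcm a b"
    by (simp_all add: coprime_part_def lcm_nat_def div_mult_swap gcd.commute[of b a] mult.commute[of a b])
  have c1: "pi * of_int p / real (lcm a b) =
    pi * (of_int (inv_mod (coprime_part a b) (coprime_part b a)) * real c * real h) / real (coprime_part b a)"
    using pos unfolding L(1)[symmetric] p_def by (simp add: mult_ac)
  have c2: "pi * of_int q / real (lcm a b) =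
    pi * (of_int (inv_mod (coprime_part b a) (coprime_part a b)) * real c * real h) / real (coprime_part a b)"
    using pos unfolding L(2)[symmetric] q_def by (simp add: mult_ac)
  have lcm: "lcm (int a) (int b) = int (lcm a b)" by simp
  have dv: "int a dvd z \<longleftrightarrow> a dvd c * gcd a b * h" "int b dvd z \<longleftrightarrow> b dvd c * gcd a b * h"
    unfolding z_def by (simp_all only: int_dvd_int_iff)
  show ?thesis
    using infsum_complementary_multiples[OF _ _ z p q summ] pos
    unfolding lcm of_int_of_nat_eq c1 c2 dv by simp
qed

text \<open>For fixed z the inner sum over x and y vanishes unless z is a multiple c gcd(a,b) h. For
  nonzero such z the cotangent expansion applies; its cotangents sum to \<open>cot_sum\<close>, and
  its corrections, present for a | z or b | z, to multiples of zeta(3). The leading factor 2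
  accounts for the sign of z.\<close>

lemma signed_triples_has_sum:
  fixes a b c :: nat
  assumes pos: "a > 0" "b > 0" "c > 0" and gcd: "gcd (gcd a b) c = 1"
    and summ: "(\<lambda>(x, y, z). 1 / real_of_int (\<bar>x\<bar> * \<bar>y\<bar> * \<bar>z\<bar>)) summable_on zero_sum_triples a b c"
  shows "((\<lambda>(x, y, z). 1 / real_of_int (x * y * \<bar>z\<bar>)) has_sum
    (2 * (pi / (real (lcm a b) * real (c * gcd a b) ^ 2) * (cot_sum a b c + cot_sum b a c)
      - zeta 3 * (1 / real (lcm a c) ^ 3 + 1 / real (lcm b c) ^ 3)))) (zero_sum_triples a b c)"
proof -
  define g where "g = gcd a b"
  have g: "g > 0" "g dvd a" "g dvd b" using pos by (auto simp: g_def)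
  have co: "coprime g c" using gcd by (simp add: g_def coprime_iff_gcd_eq_1)
  define A where "A = {z. int c dvd z}"
  define X where "X z = {x. int a dvd x \<and> int b dvd z - x}" for z
  define F where "F = (\<lambda>(x, y, z). 1 / real_of_int (x * y * \<bar>z\<bar>))"
  define H where "H = (\<lambda>z x. 1 / (real_of_int x * of_int (z - x)) * (1 / of_int \<bar>z\<bar>))"
  have "(\<lambda>t. norm (F t)) = (\<lambda>(x, y, z). 1 / real_of_int (\<bar>x\<bar> * \<bar>y\<bar> * \<bar>z\<bar>))"
    by (auto simp: F_def abs_mult)
  then have F: "F summable_on zero_sum_triples a b c"
    using summ by (intro abs_summable_summable[of F]) simp
  \<comment> \<open>The triple (x, y, z) becomes the pair (z, x') with x' = -x, so that z - x' = -y
    and x' (z - x') = x y.\<close>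
  have FH: "(F has_sum s) (zero_sum_triples a b c) \<longleftrightarrow> ((\<lambda>(z, x). H z x) has_sum s) (Sigma A X)" for s
  proof (rule has_sum_reindex_bij_witness[of _ "\<lambda>(z, x). (- x, x - z, z)" "\<lambda>(x, y, z). (z, - x)"])
    fix t assume "t \<in> zero_sum_triples a b c"
    then obtain x y z where t: "t = (x, y, z)" "int a dvd x" "int b dvd y" "int c dvd z" "x + y + z = 0"
      by (auto simp: zero_sum_triples_def)
    then have x: "x = - y - z" by simp
    have zx: "z + x = - y" using x by simp
    then have rzx: "real_of_int z + real_of_int x = - real_of_int y" by (metis of_int_add of_int_minus)
    show "(case case t of (x, y, z) \<Rightarrow> (z, - x) of (z, x) \<Rightarrow> (- x, x - z, z)) = t"
      using x by (simp add: t(1))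
    show "(case t of (x, y, z) \<Rightarrow> (z, - x)) \<in> Sigma A X"
      using t zx by (simp add: A_def X_def)
    show "(case case t of (x, y, z) \<Rightarrow> (z, - x) of (z, x) \<Rightarrow> H z x) = F t"
      by (simp add: H_def F_def t(1) rzx)
  next
    fix t assume "t \<in> Sigma A X"
    then show "(case t of (z, x) \<Rightarrow> (- x, x - z, z)) \<in> zero_sum_triples a b c"
      by (auto simp: A_def X_def zero_sum_triples_def dvd_diff_commute)
  qed auto
  have HS: "(\<lambda>(z, x). H z x) summable_on Sigma A X"
    using F unfolding summable_on_def FH .
  define V where "V = infsum F (zero_sum_triples a b c)"
  have V: "((\<lambda>(z, x). H z x) has_sum V) (Sigma A X)"
    unfolding V_def FH[symmetric] using F by (rule has_sum_infsum)
  define J where "J z = infsum (H z) (X z)" for z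
  have HX: "H z summable_on X z" if "z \<in> A" for z
    using summable_on_SigmaD1[OF HS that] .
  have J1: "(J has_sum V) A"
    by (rule has_sum_SigmaD[OF V]) (use HX in \<open>auto simp: J_def\<close>)
  \<comment> \<open>g divides both x and z - x, hence z; as g is coprime to c, all of c g divides
    z.\<close>
  have J0: "J z = 0" if "z \<in> A" "z \<notin> range (\<lambda>k. int (c * g) * k)" for z
  proof -
    have "X z = {}"
    proof (rule ccontr)
      assume "X z \<noteq> {}"
      then obtain x where "int a dvd x" "int b dvd z - x" by (auto simp: X_def)
      then have "int g dvd x" "int g dvd z - x" using g by (meson dvd_trans int_dvd_int_iff)+
      then have "int g dvd x + (z - x)" by (rule dvd_add)
      then have "int g dvd z" by simp
      moreover have "int c dvd z" using that by (simp add: A_def)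
      moreover have "coprime (int c) (int g)" using co by (simp add: coprime_commute)
      ultimately have "int c * int g dvd z" by (intro divides_mult)
      then show False using that by (auto simp: dvd_def)
    qed
    then show ?thesis by (simp add: J_def)
  qed
  define f where "f = (\<lambda>k. J (int (c * g) * k))"
  have inj: "inj (\<lambda>k. int (c * g) * k)" using pos g by (auto simp: inj_on_def)
  have "(J has_sum V) A \<longleftrightarrow> (J has_sum V) (range (\<lambda>k. int (c * g) * k))"
    using J0 by (intro has_sum_cong_neutral) (auto simp: A_def)
  also have "\<dots> \<longleftrightarrow> (f has_sum V) UNIV"
    using inj by (subst has_sum_reindex) (simp_all add: o_def f_def)
  finally have f: "(f has_sum V) UNIV" using J1 by blast
  have even: "f (- k) = f k" for k
  proof -
    define z where "z = int (c * g) * k"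
    have "J (- z) = J z"
      unfolding J_def
    proof (rule infsum_reindex_bij_witness[of _ uminus uminus])
      fix x assume "x \<in> X (- z)"
      moreover have "- z - x = - (z - - x)" by simp
      ultimately show "- x \<in> X z" unfolding X_def mem_Collect_eq by (metis dvd_minus_iff)
    next
      fix x assume "x \<in> X z"
      moreover have "- z - - x = - (z - x)" by simp
      ultimately show "- x \<in> X (- z)" unfolding X_def mem_Collect_eq by (metis dvd_minus_iff)
    next
      fix x
      have "real_of_int x * of_int (- z - x) = real_of_int (- x) * of_int (z - (- x))"
        by (simp add: algebra_simps)
      then show "H z (- x) = H (- z) x" unfolding H_def by (simp only: abs_minus_cancel)
    qed auto
    then show ?thesis by (simp add: f_def z_def)
  qed
  \<comment> \<open>For z = 0 the factor 1 / |z| is 1/0 = 0.\<close>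
  have f0: "f 0 = 0" by (simp add: f_def J_def H_def)
  have half: "((\<lambda>n. f (int (Suc n))) has_sum (V / 2)) UNIV"
    using even_has_sum_nat[OF has_sum_imp_summable[OF f] even f0] infsumI[OF f] by simp
  define C1 C2 where
    "C1 n = cot (pi * (of_int (inv_mod (coprime_part a b) (coprime_part b a)) * real c * real (Suc n)) / real (coprime_part b a))"
    and "C2 n = cot (pi * (of_int (inv_mod (coprime_part b a) (coprime_part a b)) * real c * real (Suc n)) / real (coprime_part a b))"
    for n
  \<comment> \<open>Since c | z, the condition a | z of the correction term amounts to lcm a c | z,
    and likewise for b; this is the shape that \<open>zeta_3_multiples_has_sum\<close> sums.\<close>
  define Z1 Z2 :: "nat \<Rightarrow> real" where "Z1 n = of_bool (lcm a c dvd c * g * Suc n) / real (c * g * Suc n) ^ 3"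
    and "Z2 n = of_bool (lcm b c dvd c * g * Suc n) / real (c * g * Suc n) ^ 3" for n
  define K where "K = pi / (real (lcm a b) * real (c * g) ^ 2)"
  have alg: "(pi * (C + C') / (l * (d * h)) - (e + e') / (d * h)\<^sup>2) * (1 / (d * h)) =
      pi / (l * d\<^sup>2) * (C / h\<^sup>2 + C' / h\<^sup>2) - (e / (d * h) ^ 3 + e' / (d * h) ^ 3)"
    if "l > 0" "d > 0" "h > 0" for C C' e e' l d h :: real
    using that by (simp add: field_simps power2_eq_square power3_eq_cube)
  have fform: "f (int (Suc n)) = K * (C1 n / real (Suc n) ^ 2 + C2 n / real (Suc n) ^ 2) - (Z1 n + Z2 n)" for n
  proof -
    define h where "h = Suc n"
    define z where "z = int (c * g * h)"
    have h: "h > 0" by (simp add: h_def)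
    have z0: "z > 0" using pos g h by (simp add: z_def)
    have zA: "z \<in> A" by (simp add: z_def A_def)
    have "(\<lambda>x. H z x * of_int \<bar>z\<bar>) summable_on X z"
      using HX[OF zA] by (rule summable_on_cmult_left)
    then have s: "(\<lambda>x. 1 / (of_int x * of_int (z - x)) :: real) summable_on X z"
      using z0 by (simp add: H_def)
    have "f (int h) = J z" by (simp add: f_def z_def mult_ac)
    also have "J z = (\<Sum>\<^sub>\<infinity>x\<in>X z. 1 / (of_int x * of_int (z - x)) :: real) * (1 / of_int \<bar>z\<bar>)"
      unfolding J_def H_def by (rule infsum_cmult_left')
    also have "(\<Sum>\<^sub>\<infinity>x\<in>X z. 1 / (of_int x * of_int (z - x)) :: real) =
      pi * (C1 n + C2 n) / (real (lcm a b) * of_int z)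
      - (of_bool (a dvd c * g * h) + of_bool (b dvd c * g * h)) / (of_int z)\<^sup>2"
      using complementary_multiples_sum[OF pos h] s
      unfolding X_def z_def g_def C1_def C2_def h_def[symmetric] by simp
    also have "a dvd c * g * h \<longleftrightarrow> lcm a c dvd c * g * h" by auto
    also have "b dvd c * g * h \<longleftrightarrow> lcm b c dvd c * g * h" by auto
    also have "of_int \<bar>z\<bar> = real (c * g * h)" using z0 by (simp add: z_def)
    also have "of_int z = real (c * g * h)" by (simp add: z_def)
    also have "real (c * g * h) = real (c * g) * real h" by simp
    also have "(pi * (C1 n + C2 n) / (real (lcm a b) * (real (c * g) * real h)) -
        (of_bool (lcm a c dvd c * g * h) + of_bool (lcm b c dvd c * g * h)) / (real (c * g) * real h)\<^sup>2) *
        (1 / (real (c * g) * real h)) =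
      K * (C1 n / real h ^ 2 + C2 n / real h ^ 2) -
        (of_bool (lcm a c dvd c * g * h) / (real (c * g) * real h) ^ 3 +
         of_bool (lcm b c dvd c * g * h) / (real (c * g) * real h) ^ 3)"
      unfolding K_def
      by (rule alg) (use pos g h in \<open>auto simp: lcm_pos_nat\<close>)
    finally show ?thesis
      unfolding Z1_def Z2_def h_def[symmetric] by simp
  qed
  have rhs: "((\<lambda>n. K * (C1 n / real (Suc n) ^ 2 + C2 n / real (Suc n) ^ 2) + - (Z1 n + Z2 n)) has_sum
     (K * (cot_sum a b c + cot_sum b a c) + - (zeta 3 / real (lcm a c) ^ 3 + zeta 3 / real (lcm b c) ^ 3))) UNIV"
    unfolding C1_def C2_def Z1_def Z2_def
  proof (intro has_sum_add has_sum_cmult_right has_sum_uminusI cot_sum_has_sum zeta_3_multiples_has_sum)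
    \<comment> \<open>Coprimality of g and c makes the lcm a multiple of c g, so that its multiples
      occur among the numbers c g h.\<close>
    have "c * g dvd lcm d c" if "g dvd d" for d
      using co that by (intro divides_mult) (auto simp: coprime_commute intro: dvd_trans)
    then show "c * g dvd lcm a c" "c * g dvd lcm b c" using g by auto
  qed (use pos g in \<open>auto simp: lcm_pos_nat\<close>)
  have "V / 2 = K * (cot_sum a b c + cot_sum b a c) + - (zeta 3 / real (lcm a c) ^ 3 + zeta 3 / real (lcm b c) ^ 3)"
    by (rule has_sum_unique[OF half[unfolded fform diff_conv_add_uminus] rhs])
  then have "V = 2 * (K * (cot_sum a b c + cot_sum b a c) - zeta 3 * (1 / real (lcm a c) ^ 3 + 1 / real (lcm b c) ^ 3))"
    by (simp add: algebra_simps)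
  moreover have "(F has_sum V) (zero_sum_triples a b c)" using F unfolding V_def by (rule has_sum_infsum)
  ultimately show ?thesis by (simp add: F_def K_def g_def)
qed

section \<open>Fourier expansion of the integral\<close>

text \<open>A Fatou-type argument: finite partial sums of f are limits of those of
  \<open>F j\<close> and hence at most L, which gives summability; conversely every
  \<open>s j\<close> is at most the sum of f. Convergence of the sum of f is thus a
  conclusion.\<close>

lemma nonneg_has_sum_limit:
  fixes f :: "'a \<Rightarrow> real" and F :: "nat \<Rightarrow> 'a \<Rightarrow> real"
  assumes F: "\<And>j. (F j has_sum s j) A"
    and nonneg: "\<And>j t. t \<in> A \<Longrightarrow> 0 \<le> F j t" and le: "\<And>j t. t \<in> A \<Longrightarrow> F j t \<le> f t"
    and lim: "\<And>t. t \<in> A \<Longrightarrow> (\<lambda>j. F j t) \<longlonglongrightarrow> f t" and s: "s \<longlonglongrightarrow> L"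
  shows "(f has_sum L) A"
proof -
  have f0: "0 \<le> f t" if "t \<in> A" for t using nonneg[OF that, of 0] le[OF that, of 0] by simp
  have fin: "sum f B \<le> L" if "finite B" "B \<subseteq> A" for B
  proof (rule LIMSEQ_le[OF _ s])
    show "(\<lambda>j. \<Sum>t\<in>B. F j t) \<longlonglongrightarrow> sum f B" using that lim by (intro tendsto_sum) auto
    show "\<exists>N. \<forall>n\<ge>N. sum (F n) B \<le> s n"
      using that nonneg by (auto intro!: finite_sum_le_has_sum[OF F])
  qed
  have summ: "f summable_on A"
    using f0 fin by (intro nonneg_bounded_partial_sums_imp_summable_on[where C = L])
      (auto simp: eventually_finite_subsets_at_top intro!: exI[of _ "{}"])
  then have *: "(f has_sum infsum f A) A" by (rule has_sum_infsum)
  have "infsum f A \<le> L" using summ fin by (rule infsum_le_finite_sums)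
  moreover have "L \<le> infsum f A"
    using s by (rule LIMSEQ_le_const2) (use has_sum_mono[OF F *] le in auto)
  ultimately show ?thesis using * by simp
qed

section \<open>Integrability and bounds for the logarithms\<close>

text \<open>By periodicity f is integrable on each [n, n + 1], hence on [0, a]; the substitution t =
  a x returns to [0, 1].\<close>

lemma set_integrable_periodic_scale:
  fixes f :: "real \<Rightarrow> real"
  assumes int: "set_integrable lborel {0..1} f" and per: "\<And>x. f (x + 1) = f x" and a: "a > (0::nat)"
  shows "set_integrable lborel {0..1} (\<lambda>x. f (real a * x))"
proof -
  have pern: "f (x - real n) = f x" for x n
  proof (induction n)
    case (Suc n)
    have "f (x - real (Suc n)) = f (x - real (Suc n) + 1)" by (rule per[symmetric])
    then show ?case using Suc by simp
  qed simp
  have piece: "set_integrable lborel {real n..real n + 1} f" for n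
  proof -
    have "integrable lborel (\<lambda>x. indicator {0..1} (- real n + 1 * x) *\<^sub>R f (- real n + 1 * x))"
      using int unfolding set_integrable_def by (rule lborel_integrable_real_affine) simp
    also have "(\<lambda>x. indicator {0..1} (- real n + 1 * x) *\<^sub>R f (- real n + 1 * x)) =
        (\<lambda>x. indicator {real n..real n + 1} x *\<^sub>R f x)"
      using pern by (auto simp: indicator_def fun_eq_iff)
    finally show ?thesis unfolding set_integrable_def .
  qed
  have "set_integrable lborel {0..real n} f" for n
  proof (induction n)
    case 0
    show ?case using set_integrable_subset[OF int, of "{0..0}"] by simp
  next
    case (Suc n)
    have "{0..real (Suc n)} = {0..real n} \<union> {real n..real n + 1}" by auto
    then show ?case using set_integrable_Un[OF Suc piece[of n]] by simp
  qed
  from this[of a] have "integrable lborel (\<lambda>x. indicator {0..real a} (0 + real a * x) *\<^sub>R f (0 + real a * x))"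
    unfolding set_integrable_def by (rule lborel_integrable_real_affine) (use a in simp)
  also have "(\<lambda>x. indicator {0..real a} (0 + real a * x) *\<^sub>R f (0 + real a * x)) =
      (\<lambda>x. indicator {0..1} x *\<^sub>R f (real a * x))"
    using a by (auto simp: indicator_def fun_eq_iff zero_le_mult_iff mult_le_cancel_left1)
  finally show ?thesis unfolding set_integrable_def .
qed

lemma cmod_one_minus_cis: "cmod (1 - cis (2 * x)) = 2 * \<bar>sin x\<bar>"
proof -
  have "(cmod (1 - cis (2 * x)))\<^sup>2 = (1 - cos (2 * x))\<^sup>2 + (sin (2 * x))\<^sup>2"
    by (simp add: cmod_power2)
  also have "\<dots> = 1 - 2 * cos (2 * x) + ((sin (2 * x))\<^sup>2 + (cos (2 * x))\<^sup>2)"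
    by (simp add: power2_eq_square algebra_simps)
  also have "\<dots> = 2 - 2 * cos (2 * x)" by (simp only: sin_cos_squared_add)
  also have "\<dots> = (2 * \<bar>sin x\<bar>)\<^sup>2"
    by (simp add: cos_double_sin power2_eq_square)
  finally show ?thesis by (rule power2_eq_imp_eq) auto
qed

lemma cis_2pi_neq_1:
  assumes "t \<notin> \<int>"
  shows "cis (2 * pi * t) \<noteq> 1"
proof
  assume "cis (2 * pi * t) = 1"
  then have "sin (pi * t) = 0" using cmod_one_minus_cis[of "pi * t"] by (simp add: mult.assoc)
  then obtain n where "pi * t = of_int n * pi" by (auto simp: sin_zero_iff_int2)
  then have "t = of_int n" by simp
  with assms show False by simp
qed

text \<open>On [0, 1/2] put x = pi t; then x <= 2, and the cubic Taylor bound gives sin x >= x - x^3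
  / 6 >= x / 3 >= t. The rest follows from t -> 1 - t. The product form bounds a negative power of
  the sine by a Beta integrand.\<close>

lemma sin_pi_ge:
  assumes "0 \<le> t" "t \<le> 1"
  shows "t * (1 - t) \<le> sin (pi * t)"
proof -
  have half: "t * (1 - t) \<le> sin (pi * t)" if t: "0 \<le> t" "t \<le> 1 / 2" for t :: real
  proof -
    define x where "x = pi * t"
    have x: "0 \<le> x" "x \<le> 2" using t pi_less_4 mult_mono[of pi 4 t "1/2"] by (auto simp: x_def)
    have "\<bar>sin x - x\<bar> \<le> x ^ 3 / 6"
      using Maclaurin_sin_bound[of x 3] x
      by (simp add: sin_coeff_def eval_nat_numeral field_simps)
    moreover have "x ^ 3 = x * x\<^sup>2" by (simp add: power2_eq_square power3_eq_cube)
    ultimately have "x - x * x\<^sup>2 / 6 \<le> sin x" by linarith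
    moreover have "x * x\<^sup>2 \<le> x * 4"
      using x power_mono[of x 2 2] by (intro mult_left_mono) auto
    ultimately have "x / 3 \<le> sin x" by simp
    moreover have "t \<le> x / 3" using t pi_gt3 mult_right_mono[of 3 pi t] by (simp add: x_def)
    moreover have "t * (1 - t) \<le> t" using t by (simp add: mult_left_le)
    ultimately show ?thesis by (simp add: x_def)
  qed
  show ?thesis
  proof (cases "t \<le> 1 / 2")
    case True
    then show ?thesis using half assms by simp
  next
    case False
    have "sin (pi * (1 - t)) = sin (pi * t)" by (simp add: right_diff_distrib)
    then show ?thesis using half[of "1 - t"] assms False by (simp add: mult.commute)
  qed
qed

text \<open>The inequality ln y <= y - 1 at y = s powr (- 1 / 6) gives - ln s <= 6 y - 6; this
  exponent gives the cube the integrable singularity s powr (- 1 / 2), and 216 = 6^3.\<close>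

lemma log_cube_le_powr:
  fixes s :: real
  assumes s: "0 < s" "s \<le> 1"
  shows "(ln 2 + \<bar>ln (2 * s)\<bar>) ^ 3 \<le> 216 * s powr (- 1 / 2)"
proof -
  define y where "y = s powr (- 1 / 6)"
  have "ln y \<le> y - 1" unfolding y_def using s by (intro ln_le_minus_one) auto
  then have ls: "- ln s \<le> 6 * y - 6" using s by (simp add: y_def ln_powr)
  have "ln (2::real) \<le> 1" using ln_le_minus_one[of "2::real"] by simp
  moreover have "ln s \<le> 0" using s by simp
  moreover have "ln (2 * s) = ln 2 + ln s" using s by (simp add: ln_mult)
  ultimately have "ln 2 + \<bar>ln (2 * s)\<bar> \<le> 6 * y" using ls by linarith
  then have "(ln 2 + \<bar>ln (2 * s)\<bar>) ^ 3 \<le> (6 * y) ^ 3"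
    by (intro power_mono) auto
  also have "\<dots> = 216 * y ^ 3" by (simp add: power_mult_distrib)
  also have "y ^ 3 = s powr (- 1 / 2)"
    unfolding y_def using s by (simp add: powr_power)
  finally show ?thesis .
qed

text \<open>At r = 1 and with argument a t this is log |x^a - 1| on the unit circle; r < 1 gives the
  Abel regularisation.\<close>

definition log_dist :: "real \<Rightarrow> real \<Rightarrow> real" where
  "log_dist r t = ln (cmod (1 - of_real r * cis (2 * pi * t)))"

lemma log_dist_measurable [measurable]: "log_dist r \<in> borel_measurable borel"
proof -
  have "(\<lambda>t. cmod (1 - of_real r * cis (2 * pi * t))) \<in> borel_measurable borel"
    by (intro borel_measurable_continuous_onI continuous_intros)
  then have "(\<lambda>t. ln (cmod (1 - of_real r * cis (2 * pi * t)))) \<in> borel_measurable borel"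
    by (rule borel_measurable_ln)
  then show ?thesis unfolding log_dist_def[abs_def] .
qed

text \<open>The majorant is 216 times the integrand of the Beta integral at (1/2, 1/2). The shift by
  ln 2 makes the cube dominate |log_dist r|^3 for all r in [0, 1] off the integers, by
  \<open>log_dist_le\<close>.\<close>

lemma log_dist_cube_integrable:
  "set_integrable lborel {0..1} (\<lambda>t. (ln 2 + \<bar>log_dist 1 t\<bar>) ^ 3)"
proof (rule set_integrable_bound)
  show "set_integrable lborel {0..1} (\<lambda>t::real. 216 * (t powr (1 / 2 - 1) * (1 - t) powr (1 / 2 - 1)))"
    by (intro set_integrable_mult_right integrable_Beta) auto
  show "set_borel_measurable lborel {0..1} (\<lambda>t. (ln 2 + \<bar>log_dist 1 t\<bar>) ^ 3)"
    unfolding set_borel_measurable_def by measurable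
  have "AE t in lborel. t \<noteq> 0 \<and> t \<noteq> (1::real)"
    using AE_lborel_singleton[of "0::real"] AE_lborel_singleton[of "1::real"] by eventually_elim auto
  then show "AE t in lborel. t \<in> {0..1} \<longrightarrow> norm ((ln 2 + \<bar>log_dist 1 t\<bar>) ^ 3) \<le>
      norm (216 * (t powr (1 / 2 - 1) * (1 - t) powr (1 / 2 - 1)))"
  proof eventually_elim
    case (elim t)
    show ?case
    proof
      assume "t \<in> {0..1}"
      with elim have t: "0 < t" "t < 1" by auto
      then have p: "0 < t * (1 - t)" by simp
      have s: "t * (1 - t) \<le> sin (pi * t)" using t by (intro sin_pi_ge) auto
      have "log_dist 1 t = ln (2 * sin (pi * t))"
        using cmod_one_minus_cis[of "pi * t"] s p by (simp add: log_dist_def mult.assoc)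
      then have "(ln 2 + \<bar>log_dist 1 t\<bar>) ^ 3 \<le> 216 * sin (pi * t) powr (- 1 / 2)"
        using log_cube_le_powr[of "sin (pi * t)"] s p by simp
      also have "sin (pi * t) powr (- 1 / 2) \<le> (t * (1 - t)) powr (- 1 / 2)"
        using s p by (intro powr_mono2') auto
      also have "\<dots> = t powr (1 / 2 - 1) * (1 - t) powr (1 / 2 - 1)"
        using t by (simp add: powr_mult)
      finally show "norm ((ln 2 + \<bar>log_dist 1 t\<bar>) ^ 3) \<le>
          norm (216 * (t powr (1 / 2 - 1) * (1 - t) powr (1 / 2 - 1)))"
        by simp
    qed
  qed
qed

text \<open>With w = e(t), the triangle inequality gives |1 - w| <= |1 - r w| + (1 - r) <= 2 |1 - r
  w|, and |1 - r w| <= 2. The bound is uniform in r.\<close>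

lemma log_dist_le:
  assumes r: "0 \<le> r" "r \<le> 1" and t: "t \<notin> \<int>"
  shows "\<bar>log_dist r t\<bar> \<le> ln 2 + \<bar>log_dist 1 t\<bar>"
proof -
  define w where "w = cis (2 * pi * t)"
  have pos1: "0 < cmod (1 - w)"
    using cis_2pi_neq_1[OF t] by (simp add: w_def)
  have w: "cmod w = 1" by (simp add: w_def)
  have "cmod (1 - w) = cmod ((1 - of_real r * w) - of_real (1 - r) * w)" by (simp add: algebra_simps)
  also have "\<dots> \<le> cmod (1 - of_real r * w) + cmod (of_real (1 - r) * w)" by (rule norm_triangle_ineq4)
  also have "cmod (of_real (1 - r) * w) = 1 - r" using r w by (simp add: norm_mult del: of_real_diff)
  also have "1 - r \<le> cmod (1 - of_real r * w)"
    using norm_triangle_ineq2[of 1 "of_real r * w"] r w by (simp add: norm_mult)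
  finally have lower: "cmod (1 - w) / 2 \<le> cmod (1 - of_real r * w)" by simp
  have upper: "cmod (1 - of_real r * w) \<le> 2"
    using norm_triangle_ineq4[of 1 "of_real r * w"] r w by (simp add: norm_mult)
  have "ln (cmod (1 - w) / 2) \<le> log_dist r t"
    unfolding log_dist_def w_def[symmetric] using lower pos1 by (intro ln_mono) auto
  moreover have "ln (cmod (1 - w) / 2) = log_dist 1 t - ln 2"
    using pos1 by (simp add: log_dist_def w_def ln_div)
  moreover have "log_dist r t \<le> ln 2"
    unfolding log_dist_def w_def[symmetric] using lower upper pos1 by (intro ln_mono) auto
  ultimately show ?thesis by (auto simp: abs_le_iff)
qed

section \<open>Fourier series at radius r < 1\<close>

text \<open>For 0 <= r < 1 these are the Fourier coefficients of - 2 log |1 - r e(t)|; division by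
  zero gives the coefficient 0 at k = 0, the correct mean value.\<close>

definition fourier_weight :: "real \<Rightarrow> int \<Rightarrow> real" where
  "fourier_weight r k = r ^ nat \<bar>k\<bar> / of_int \<bar>k\<bar>"

definition fourier_partial_sum :: "real \<Rightarrow> nat \<Rightarrow> real \<Rightarrow> complex" where
  "fourier_partial_sum r N t =
     (\<Sum>k\<in>{- int N..int N}. of_real (fourier_weight r k) * cis (2 * pi * of_int k * t))"

lemma fourier_weight_nonneg: "0 \<le> r \<Longrightarrow> 0 \<le> fourier_weight r k"
  by (simp add: fourier_weight_def)

lemma fourier_weight_Suc:
  "fourier_weight r (int (Suc n)) = r ^ Suc n / real (Suc n)"
  "fourier_weight r (- int (Suc n)) = r ^ Suc n / real (Suc n)"
proof -
  have "nat \<bar>int (Suc n)\<bar> = Suc n" "nat \<bar>- int (Suc n)\<bar> = Suc n" by linarith+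
  then show "fourier_weight r (int (Suc n)) = r ^ Suc n / real (Suc n)"
      "fourier_weight r (- int (Suc n)) = r ^ Suc n / real (Suc n)"
    unfolding fourier_weight_def by simp_all
qed

text \<open>The terms at k and -k are conjugate and add up to twice the real part of w^k / k with w
  = r e(t); the power series of - ln (1 - w) has real part - log |1 - w|.\<close>

lemma fourier_partial_sum_tendsto:
  assumes r: "0 \<le> r" "r < 1"
  shows "(\<lambda>N. fourier_partial_sum r N t) \<longlonglongrightarrow> of_real (- 2 * log_dist r t)"
proof -
  define w where "w = of_real r * cis (2 * pi * t)"
  have w: "cmod w < 1" using r by (simp add: w_def norm_mult)
  have eq: "fourier_partial_sum r N t = of_real (2 * (\<Sum>n<N. Re (w ^ Suc n / of_nat (Suc n))))" for N
  proof -
    have "of_real (fourier_weight r (int (Suc n))) * cis (2 * pi * of_int (int (Suc n)) * t) +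
        of_real (fourier_weight r (- int (Suc n))) * cis (2 * pi * of_int (- int (Suc n)) * t) =
        of_real (2 * Re (w ^ Suc n / of_nat (Suc n)))" (is "?p + ?q = _") for n
    proof -
      have wp: "w ^ Suc n = of_real (r ^ Suc n) * cis (2 * pi * real (Suc n) * t)"
      proof -
        have "w ^ Suc n = of_real r ^ Suc n * cis (2 * pi * t) ^ Suc n"
          by (simp only: w_def power_mult_distrib)
        also have "cis (2 * pi * t) ^ Suc n = cis (real (Suc n) * (2 * pi * t))" by (rule Complex.DeMoivre)
        finally show ?thesis by (simp only: of_real_power mult_ac)
      qed
      have p: "?p = w ^ Suc n / of_nat (Suc n)"
        unfolding fourier_weight_Suc wp by (simp add: mult_ac)
      have "?q = cnj ?p"
        unfolding fourier_weight_Suc by (simp add: cis_cnj del: of_nat_Suc)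
      then have "?p + ?q = of_real (2 * Re ?p)" by (simp only: complex_add_cnj)
      then show ?thesis unfolding p .
    qed
    then show ?thesis
      unfolding fourier_partial_sum_def sum_int_Icc_eq
      by (simp add: fourier_weight_def[of _ 0] sum_distrib_left del: of_nat_Suc power_Suc)
  qed
  have "(\<lambda>n. - ((- (- w)) ^ n) / of_nat n) sums ln (1 + (- w))" using w by (intro Ln_series') simp
  then have "(\<lambda>n. - (w ^ n / of_nat n)) sums ln (1 - w)" by simp
  then have "(\<lambda>n. w ^ n / of_nat n) sums (- ln (1 - w))" using sums_minus by fastforce
  then have "(\<lambda>n. w ^ Suc n / of_nat (Suc n)) sums (- ln (1 - w))"
    using sums_Suc_iff[of "\<lambda>n. w ^ n / of_nat n" "- ln (1 - w)"] by simp
  then have "(\<lambda>n. Re (w ^ Suc n / of_nat (Suc n))) sums Re (- ln (1 - w))" by (rule sums_Re)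
  moreover have "Re (- ln (1 - w)) = - log_dist r t"
  proof -
    have "1 - w \<noteq> 0" using w by auto
    then show ?thesis by (simp add: Re_Ln log_dist_def w_def)
  qed
  ultimately have "(\<lambda>N. \<Sum>n<N. Re (w ^ Suc n / of_nat (Suc n))) \<longlonglongrightarrow> - log_dist r t"
    by (simp only: sums_def)
  then have "(\<lambda>N. complex_of_real (2 * (\<Sum>n<N. Re (w ^ Suc n / of_nat (Suc n)))))
      \<longlonglongrightarrow> of_real (2 * (- log_dist r t))"
    by (intro tendsto_intros)
  then show ?thesis unfolding eq by simp
qed

text \<open>Comparison with a geometric series; uniformity in N and t is what dominated convergence
  as N grows needs.\<close>

lemma fourier_partial_sum_bound:
  assumes r: "0 \<le> r" "r < 1"
  shows "cmod (fourier_partial_sum r N t) \<le> 2 / (1 - r)"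
proof -
  have "cmod (fourier_partial_sum r N t) \<le>
      (\<Sum>k\<in>{- int N..int N}. cmod (of_real (fourier_weight r k) * cis (2 * pi * of_int k * t)))"
    unfolding fourier_partial_sum_def by (rule norm_sum)
  also have "\<dots> = (\<Sum>k\<in>{- int N..int N}. fourier_weight r k)"
    using r by (simp add: norm_mult fourier_weight_nonneg)
  also have "\<dots> = (\<Sum>n<N. 2 * (r ^ Suc n / real (Suc n)))"
    unfolding sum_int_Icc_eq fourier_weight_Suc by (simp add: fourier_weight_def)
  also have "\<dots> \<le> (\<Sum>n<N. 2 * r ^ n)"
  proof (rule sum_mono)
    fix n
    have "r ^ Suc n / real (Suc n) \<le> r ^ Suc n / 1" using r by (intro divide_left_mono) auto
    also have "\<dots> \<le> r ^ n" using r by (simp add: mult_left_le_one_le)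
    finally show "2 * (r ^ Suc n / real (Suc n)) \<le> 2 * r ^ n" by simp
  qed
  also have "\<dots> = 2 * (\<Sum>n<N. r ^ n)" by (simp add: sum_distrib_left)
  also have "(\<Sum>n<N. r ^ n) \<le> (\<Sum>n. r ^ n)" using r by (intro sum_le_suminf summable_geometric) auto
  also have "(\<Sum>n. r ^ n) = 1 / (1 - r)" using r by (intro suminf_geometric) auto
  finally show ?thesis by simp
qed

lemma integral_cis:
  "(LBINT t:{0..1}. cis (2 * pi * of_int j * t)) = of_bool (j = 0)"
proof (cases "j = 0")
  case True
  then show ?thesis by (simp add: set_lebesgue_integral_def)
next
  case False
  define F where "F t = cis (2 * pi * of_int j * t) / (2 * pi * of_int j * \<i>)" for t
  have "((\<lambda>t. cis (2 * pi * of_int j * t)) has_integral (F 1 - F 0)) {0..1}"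
  proof (rule fundamental_theorem_of_calculus)
    fix t :: real
    have "((\<lambda>t. exp (\<i> * of_real (2 * pi * of_int j * t)) / (2 * pi * of_int j * \<i>)) has_vector_derivative
        exp (\<i> * of_real (2 * pi * of_int j * t))) (at t within {0..1})"
      using False by (auto intro!: derivative_eq_intros has_vector_derivative_real_field simp: field_simps)
    then show "(F has_vector_derivative cis (2 * pi * of_int j * t)) (at t within {0..1})"
      unfolding F_def cis_conv_exp by simp
  qed simp
  moreover have "F 1 = F 0"
    using cis_multiple_2pi[of "of_int j"] by (simp add: F_def mult_ac)
  ultimately have "integral {0..1} (\<lambda>t. cis (2 * pi * of_int j * t)) = 0" by (simp add: integral_unique)
  moreover have "set_integrable lborel {0..1} (\<lambda>t. cis (2 * pi * of_int j * t))"
    by (intro borel_integrable_atLeastAtMost' continuous_intros)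
  ultimately show ?thesis using False by (simp add: set_borel_integral_eq_integral)
qed

text \<open>The index triples whose term in the product of the Fourier series at a t, b t and c t
  has frequency 0 and survives integration.\<close>

definition relation_triples :: "nat \<Rightarrow> nat \<Rightarrow> nat \<Rightarrow> (int \<times> int \<times> int) set" where
  "relation_triples a b c = {(k, l, m). int a * k + int b * l + int c * m = 0}"

text \<open>After multiplying out, \<open>integral_cis\<close> keeps exactly the terms of total
  frequency 0.\<close>

lemma integral_fourier_partial_sums:
  fixes a b c :: nat
  defines "B \<equiv> \<lambda>N. {- int N..int N} \<times> {- int N..int N} \<times> {- int N..int N}"
  shows "(LBINT t:{0..1}. fourier_partial_sum r N (real a * t) * fourier_partial_sum r N (real b * t) *
      fourier_partial_sum r N (real c * t)) =
    of_real (\<Sum>(k, l, m)\<in>relation_triples a b c \<inter> B N. fourier_weight r k * fourier_weight r l * fourier_weight r m)"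
proof -
  define w where "w = fourier_weight r"
  define W where "W = (\<lambda>(k, l, m). w k * w l * w m)"
  define j where "j = (\<lambda>(k, l, m). int a * k + int b * l + int c * m)"
  have expand: "fourier_partial_sum r N (real a * t) * fourier_partial_sum r N (real b * t) *
      fourier_partial_sum r N (real c * t) =
    (\<Sum>p\<in>B N. of_real (W p) * cis (2 * pi * of_int (j p) * t))" for t
  proof -
    have "fourier_partial_sum r N (real a * t) * (fourier_partial_sum r N (real b * t) *
      fourier_partial_sum r N (real c * t)) =
      (\<Sum>k\<in>{- int N..int N}. \<Sum>l\<in>{- int N..int N}. \<Sum>m\<in>{- int N..int N}.
        (of_real (w k) * cis (2 * pi * of_int k * (real a * t))) *
        ((of_real (w l) * cis (2 * pi * of_int l * (real b * t))) *
         (of_real (w m) * cis (2 * pi * of_int m * (real c * t)))))"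
      by (simp only: fourier_partial_sum_def w_def sum_product) (simp only: sum_distrib_left)
    also have "\<dots> = (\<Sum>k\<in>{- int N..int N}. \<Sum>l\<in>{- int N..int N}. \<Sum>m\<in>{- int N..int N}.
        of_real (W (k, l, m)) * cis (2 * pi * of_int (j (k, l, m)) * t))"
    proof (intro sum.cong refl)
      fix k l m
      have "2 * pi * of_int (j (k, l, m)) * t = 2 * pi * of_int k * (real a * t) +
          (2 * pi * of_int l * (real b * t) + 2 * pi * of_int m * (real c * t))"
        by (simp add: j_def algebra_simps)
      then have "cis (2 * pi * of_int (j (k, l, m)) * t) = cis (2 * pi * of_int k * (real a * t)) *
          (cis (2 * pi * of_int l * (real b * t)) * cis (2 * pi * of_int m * (real c * t)))"
        by (simp only: cis_mult)
      then show "(of_real (w k) * cis (2 * pi * of_int k * (real a * t))) *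
        ((of_real (w l) * cis (2 * pi * of_int l * (real b * t))) *
         (of_real (w m) * cis (2 * pi * of_int m * (real c * t)))) =
        of_real (W (k, l, m)) * cis (2 * pi * of_int (j (k, l, m)) * t)"
        by (simp add: W_def mult_ac)
    qed
    also have "\<dots> = (\<Sum>p\<in>B N. of_real (W p) * cis (2 * pi * of_int (j p) * t))"
      unfolding B_def by (simp add: sum.cartesian_product case_prod_beta)
    finally show ?thesis by (simp only: mult.assoc)
  qed
  have fin: "finite (B N)" by (simp add: B_def)
  have int: "integrable lborel (\<lambda>t. indicator {0..1} t *\<^sub>R (of_real (W p) * cis (2 * pi * of_int (j p) * t)))" for p
    unfolding set_integrable_def[symmetric]
    by (intro borel_integrable_atLeastAtMost' continuous_intros)
  have "(LBINT t:{0..1}. (\<Sum>p\<in>B N. of_real (W p) * cis (2 * pi * of_int (j p) * t))) =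
      (\<Sum>p\<in>B N. LBINT t:{0..1}. of_real (W p) * cis (2 * pi * of_int (j p) * t))"
    unfolding set_lebesgue_integral_def scaleR_sum_right
    by (rule Bochner_Integration.integral_sum) (rule int)
  also have "\<dots> = (\<Sum>p\<in>B N. of_real (W p) * of_bool (j p = 0))"
    by (simp only: set_integral_mult_right integral_cis)
  also have "\<dots> = (\<Sum>p\<in>relation_triples a b c \<inter> B N. of_real (W p))"
    by (rule sum.mono_neutral_cong_right[OF fin]) (auto simp: relation_triples_def j_def)
  also have "\<dots> = of_real (\<Sum>(k, l, m)\<in>relation_triples a b c \<inter> B N. w k * w l * w m)"
    by (simp add: W_def case_prod_beta)
  finally show ?thesis unfolding expand w_def .
qed

text \<open>The limit of \<open>integral_fourier_partial_sums\<close> as N grows: a factor -2 per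
  logarithm gives -8, dominated convergence handles the integral, and truncation to the box
  \<open>B N\<close> handles the sum, since all weights are nonnegative.\<close>

lemma fourier_weights_has_sum:
  fixes a b c :: nat
  assumes r: "0 \<le> r" "r < 1"
  shows "((\<lambda>(k, l, m). fourier_weight r k * fourier_weight r l * fourier_weight r m) has_sum
    (- 8 * (LBINT t:{0..1}. log_dist r (real a * t) * log_dist r (real b * t) * log_dist r (real c * t))))
    (relation_triples a b c)"
proof -
  define W where "W = (\<lambda>(k, l, m). fourier_weight r k * fourier_weight r l * fourier_weight r m)"
  define B where "B N = {- int N..int N} \<times> {- int N..int N} \<times> {- int N..int N}" for N
  define s where "s N = sum W (relation_triples a b c \<inter> B N)" for N
  define I where "I = (LBINT t:{0..1}. log_dist r (real a * t) * log_dist r (real b * t) * log_dist r (real c * t))"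
  define P where "P = (\<lambda>N t. fourier_partial_sum r N (real a * t) * fourier_partial_sum r N (real b * t) *
      fourier_partial_sum r N (real c * t))"
  have W0: "0 \<le> W p" for p using r by (auto simp: W_def fourier_weight_nonneg split: prod.split)
  have s_eq: "(LBINT t:{0..1}. P N t) = of_real (s N)" for N
    unfolding P_def integral_fourier_partial_sums s_def W_def B_def ..
  have contP: "continuous_on A (P N)" for N A
    unfolding P_def fourier_partial_sum_def by (intro continuous_intros)
  define C where "C = 2 / (1 - r)"
  have C0: "0 \<le> C" using r by (simp add: C_def)
  have "(\<lambda>N. LBINT t:{0..1}. P N t) \<longlonglongrightarrow>
    (LBINT t:{0..1}. complex_of_real (- 8 * (log_dist r (real a * t) * log_dist r (real b * t) * log_dist r (real c * t))))"
    unfolding set_lebesgue_integral_def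
  proof (rule integral_dominated_convergence[where w = "\<lambda>t::real. indicator {0..1} t *\<^sub>R (C * C * C)"])
    show "(\<lambda>t. indicator {0..1} t *\<^sub>R complex_of_real (- 8 * (log_dist r (real a * t) * log_dist r (real b * t) * log_dist r (real c * t))))
        \<in> borel_measurable lborel" by measurable
    show "(\<lambda>t. indicator {0..1} t *\<^sub>R P N t) \<in> borel_measurable lborel" for N
      using borel_measurable_continuous_onI[OF contP] by measurable
    show "integrable lborel (\<lambda>t::real. indicator {0..1} t *\<^sub>R (C * C * C))"
      unfolding set_integrable_def[symmetric] by (intro borel_integrable_atLeastAtMost' continuous_intros)
    show "AE t in lborel. (\<lambda>N. indicator {0..1} t *\<^sub>R P N t) \<longlonglongrightarrow>
        indicator {0..1} t *\<^sub>R complex_of_real (- 8 * (log_dist r (real a * t) * log_dist r (real b * t) * log_dist r (real c * t)))"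
    proof (rule AE_I2)
      fix t :: real
      have "(\<lambda>N. P N t) \<longlonglongrightarrow> of_real (- 2 * log_dist r (real a * t)) * of_real (- 2 * log_dist r (real b * t)) *
          of_real (- 2 * log_dist r (real c * t))"
        unfolding P_def by (intro tendsto_mult fourier_partial_sum_tendsto r)
      then have "(\<lambda>N. indicator {0..1} t *\<^sub>R P N t) \<longlonglongrightarrow> indicator {0..1} t *\<^sub>R
         (of_real (- 2 * log_dist r (real a * t)) * of_real (- 2 * log_dist r (real b * t)) *
          of_real (- 2 * log_dist r (real c * t)))" by (intro tendsto_intros)
      then show "(\<lambda>N. indicator {0..1} t *\<^sub>R P N t) \<longlonglongrightarrow>
        indicator {0..1} t *\<^sub>R complex_of_real (- 8 * (log_dist r (real a * t) * log_dist r (real b * t) * log_dist r (real c * t)))"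
        by (simp add: mult_ac)
    qed
    show "AE t in lborel. norm (indicator {0..1} t *\<^sub>R P N t) \<le> indicator {0..1} t *\<^sub>R (C * C * C)" for N
    proof (rule AE_I2)
      fix t :: real
      have "norm (P N t) \<le> C * C * C"
        unfolding P_def norm_mult C_def using fourier_partial_sum_bound[OF r] C0
        by (intro mult_mono) (auto simp: C_def)
      then show "norm (indicator {0..1} t *\<^sub>R P N t) \<le> indicator {0..1} t *\<^sub>R (C * C * C)"
        by (auto simp: indicator_def)
    qed
  qed
  then have "(\<lambda>N. complex_of_real (s N)) \<longlonglongrightarrow> of_real (- 8 * I)"
    unfolding s_eq set_integral_complex_of_real set_integral_mult_right I_def .
  then have lim: "s \<longlonglongrightarrow> - 8 * I" by (simp only: tendsto_of_real_iff)
  have "(W has_sum (- 8 * I)) (relation_triples a b c)"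
  proof (rule nonneg_has_sum_limit[OF _ _ _ _ lim])
    fix N
    have "(W has_sum s N) (relation_triples a b c \<inter> B N)"
      unfolding s_def by (rule has_sum_finite) (simp add: B_def)
    also have "?this \<longleftrightarrow> ((\<lambda>p. if p \<in> B N then W p else 0) has_sum s N) (relation_triples a b c)"
      by (rule has_sum_cong_neutral) auto
    finally show "((\<lambda>p. if p \<in> B N then W p else 0) has_sum s N) (relation_triples a b c)" .
  next
    fix p :: "int \<times> int \<times> int"
    obtain k l m where p: "p = (k, l, m)" by (cases p)
    have "eventually (\<lambda>N. p \<in> B N) sequentially"
      using eventually_ge_at_top[of "nat (max \<bar>k\<bar> (max \<bar>l\<bar> \<bar>m\<bar>))"]
      by eventually_elim (auto simp: B_def p)
    then have "eventually (\<lambda>N. W p = (if p \<in> B N then W p else 0)) sequentially"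
      by eventually_elim simp
    then show "(\<lambda>N. if p \<in> B N then W p else 0) \<longlonglongrightarrow> W p"
      by (rule Lim_transform_eventually[OF tendsto_const])
  qed (auto simp: W0)
  then show ?thesis by (simp only: W_def I_def)
qed

section \<open>The limit as r tends to 1\<close>

lemma AE_mult_not_Ints:
  assumes "a > (0::nat)"
  shows "AE t in lborel. real a * t \<notin> \<int>"
proof -
  have "{t. real a * t \<in> \<int>} = (\<lambda>x. x / real a) ` \<int>"
    using assms by (auto simp: image_iff field_simps intro!: bexI[of _ "real a * _"])
  then have "countable {t. real a * t \<in> \<int>}" by (simp add: Ints_def)
  then have "{t. real a * t \<in> \<int>} \<in> null_sets lborel" by (rule countable_imp_null_set_lborel)
  then have "AE t in lborel. t \<notin> {t. real a * t \<in> \<int>}" by (rule AE_not_in)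
  then show ?thesis by simp
qed

lemma log_dist_periodic: "log_dist r (t + 1) = log_dist r t"
proof -
  have "cis (2 * pi * (t + 1)) = cis (2 * pi * t) * cis (2 * pi)"
    by (simp add: cis_mult algebra_simps)
  then show ?thesis by (simp add: log_dist_def)
qed

lemma log_dist_tendsto:
  assumes "t \<notin> \<int>" "\<rho> \<longlonglongrightarrow> 1"
  shows "(\<lambda>j. log_dist (\<rho> j) t) \<longlonglongrightarrow> log_dist 1 t"
proof -
  have "cmod (1 - of_real 1 * cis (2 * pi * t)) \<noteq> 0"
    using cis_2pi_neq_1[OF assms(1)] by simp
  then show ?thesis
    unfolding log_dist_def by (intro tendsto_intros assms)
qed

text \<open>Reduces domination of a product of three logarithms to integrability of the cube of a
  single one.\<close>

lemma mult3_le_sum_cubes: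
  fixes x y z :: real
  assumes "0 \<le> x" "0 \<le> y" "0 \<le> z"
  shows "x * y * z \<le> x ^ 3 + y ^ 3 + z ^ 3"
proof -
  define M where "M = max x (max y z)"
  have M: "x \<le> M" "y \<le> M" "z \<le> M" by (auto simp: M_def)
  have "x * y * z \<le> M * M * M" using assms M by (intro mult_mono) auto
  also have "\<dots> = M ^ 3" by (simp add: power3_eq_cube)
  also have "M ^ 3 \<le> x ^ 3 + y ^ 3 + z ^ 3"
    using assms by (auto simp: M_def max_def)
  finally show ?thesis .
qed

text \<open>The radii 1 - 1 / (j + 1) tend to 1. The integrals converge by dominated convergence
  with the cubes \<open>D\<close>; the sums by \<open>nonneg_has_sum_limit\<close>, since the
  weights are at most 1 / |k| and tend to it. Convergence of the triple sum is part of the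
  outcome.\<close>

lemma relation_triples_has_sum:
  fixes a b c :: nat
  assumes pos: "a > 0" "b > 0" "c > 0"
  shows "((\<lambda>(k, l, m). 1 / real_of_int (\<bar>k\<bar> * \<bar>l\<bar> * \<bar>m\<bar>)) has_sum
    (- 8 * (LBINT t:{0..1}. log_dist 1 (real a * t) * log_dist 1 (real b * t) * log_dist 1 (real c * t))))
    (relation_triples a b c)"
proof -
  define \<rho> where "\<rho> j = 1 - 1 / real (Suc j)" for j
  have \<rho>: "0 \<le> \<rho> j" "\<rho> j < 1" for j by (auto simp: \<rho>_def)
  have \<rho>1: "\<rho> \<longlonglongrightarrow> 1" unfolding \<rho>_def by real_asymp
  define D where "D t = (ln 2 + \<bar>log_dist 1 t\<bar>) ^ 3" for t
  have D: "set_integrable lborel {0..1} (\<lambda>t. D (real d * t))" if "d > 0" for d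
    by (rule set_integrable_periodic_scale[OF _ _ that])
      (use log_dist_cube_integrable in \<open>auto simp: D_def log_dist_periodic\<close>)
  \<comment> \<open>Off the integers the pointwise limit and the uniform bound hold; the exceptional
    set is countable.\<close>
  have AE: "AE t in lborel. real a * t \<notin> \<int> \<and> real b * t \<notin> \<int> \<and> real c * t \<notin> \<int>"
    using AE_mult_not_Ints[OF pos(1)] AE_mult_not_Ints[OF pos(2)] AE_mult_not_Ints[OF pos(3)]
    by eventually_elim auto
  have "(\<lambda>j. LBINT t:{0..1}. log_dist (\<rho> j) (real a * t) * log_dist (\<rho> j) (real b * t) * log_dist (\<rho> j) (real c * t))
    \<longlonglongrightarrow> (LBINT t:{0..1}. log_dist 1 (real a * t) * log_dist 1 (real b * t) * log_dist 1 (real c * t))"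
    unfolding set_lebesgue_integral_def
  proof (rule integral_dominated_convergence[where
        w = "\<lambda>t. indicator {0..1} t *\<^sub>R (D (real a * t) + D (real b * t) + D (real c * t))"])
    show "integrable lborel (\<lambda>t. indicator {0..1} t *\<^sub>R (D (real a * t) + D (real b * t) + D (real c * t)))"
      unfolding set_integrable_def[symmetric] by (intro set_integral_add D pos)
    show "AE t in lborel. (\<lambda>j. indicator {0..1} t *\<^sub>R
        (log_dist (\<rho> j) (real a * t) * log_dist (\<rho> j) (real b * t) * log_dist (\<rho> j) (real c * t))) \<longlonglongrightarrow>
        indicator {0..1} t *\<^sub>R (log_dist 1 (real a * t) * log_dist 1 (real b * t) * log_dist 1 (real c * t))"
      using AE by eventually_elim (intro tendsto_intros log_dist_tendsto \<rho>1; simp)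
    show "AE t in lborel. norm (indicator {0..1} t *\<^sub>R
        (log_dist (\<rho> j) (real a * t) * log_dist (\<rho> j) (real b * t) * log_dist (\<rho> j) (real c * t))) \<le>
        indicator {0..1} t *\<^sub>R (D (real a * t) + D (real b * t) + D (real c * t))" for j
      using AE
    proof eventually_elim
      case (elim t)
      define E where "E d = ln 2 + \<bar>log_dist 1 (real d * t)\<bar>" for d
      have E0: "0 \<le> E d" for d by (simp add: E_def)
      have le: "\<bar>log_dist (\<rho> j) (real d * t)\<bar> \<le> E d" if "real d * t \<notin> \<int>" for d
        unfolding E_def using \<rho>[of j] that by (intro log_dist_le) auto
      have "\<bar>log_dist (\<rho> j) (real a * t)\<bar> * \<bar>log_dist (\<rho> j) (real b * t)\<bar> * \<bar>log_dist (\<rho> j) (real c * t)\<bar>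
          \<le> E a * E b * E c"
        using elim E0 by (intro mult_mono le) auto
      also have "\<dots> \<le> E a ^ 3 + E b ^ 3 + E c ^ 3" using E0 by (intro mult3_le_sum_cubes)
      finally show ?case by (auto simp: indicator_def abs_mult D_def E_def)
    qed
  qed measurable
  then have lim: "(\<lambda>j. - 8 * (LBINT t:{0..1}. log_dist (\<rho> j) (real a * t) * log_dist (\<rho> j) (real b * t) * log_dist (\<rho> j) (real c * t)))
    \<longlonglongrightarrow> - 8 * (LBINT t:{0..1}. log_dist 1 (real a * t) * log_dist 1 (real b * t) * log_dist 1 (real c * t))"
    by (intro tendsto_intros)
  have wle: "fourier_weight (\<rho> j) k \<le> fourier_weight 1 k" for j k
    unfolding fourier_weight_def using \<rho>[of j] by (intro divide_right_mono power_mono) auto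
  have w0: "0 \<le> fourier_weight (\<rho> j) k" "0 \<le> fourier_weight 1 k" for j k
    using \<rho>[of j] by (auto intro: fourier_weight_nonneg)
  have wlim: "(\<lambda>j. fourier_weight (\<rho> j) k) \<longlonglongrightarrow> fourier_weight 1 k" for k
    unfolding fourier_weight_def divide_inverse by (intro tendsto_intros \<rho>1)
  have "((\<lambda>(k, l, m). fourier_weight 1 k * fourier_weight 1 l * fourier_weight 1 m) has_sum
    (- 8 * (LBINT t:{0..1}. log_dist 1 (real a * t) * log_dist 1 (real b * t) * log_dist 1 (real c * t))))
    (relation_triples a b c)"
  proof (rule nonneg_has_sum_limit[OF fourier_weights_has_sum[OF \<rho>] _ _ _ lim])
    fix j and p :: "int \<times> int \<times> int"
    show "0 \<le> (case p of (k, l, m) \<Rightarrow> fourier_weight (\<rho> j) k * fourier_weight (\<rho> j) l * fourier_weight (\<rho> j) m)"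
      by (auto simp: w0 split: prod.split)
    show "(case p of (k, l, m) \<Rightarrow> fourier_weight (\<rho> j) k * fourier_weight (\<rho> j) l * fourier_weight (\<rho> j) m) \<le>
        (case p of (k, l, m) \<Rightarrow> fourier_weight 1 k * fourier_weight 1 l * fourier_weight 1 m)"
      by (auto simp: w0 wle split: prod.split intro!: mult_mono)
    show "(\<lambda>j. case p of (k, l, m) \<Rightarrow> fourier_weight (\<rho> j) k * fourier_weight (\<rho> j) l * fourier_weight (\<rho> j) m) \<longlonglongrightarrow>
        (case p of (k, l, m) \<Rightarrow> fourier_weight 1 k * fourier_weight 1 l * fourier_weight 1 m)"
      by (cases p) (auto intro!: tendsto_mult wlim)
  qed
  then show ?thesis by (simp add: fourier_weight_def)
qed

section \<open>The Mahler measure as a sum over zero-sum triples\<close>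

lemma multiple_mahler_eq_log_dist:
  "multiple_mahler (monom 1 a - 1) (monom 1 b - 1) (monom 1 c - 1) =
    (LBINT t:{0..1}. log_dist 1 (real a * t) * log_dist 1 (real b * t) * log_dist 1 (real c * t))"
proof -
  have "ln (cmod (poly (monom 1 d - 1) (exp (2 * of_real pi * \<i> * of_real t)))) = log_dist 1 (real d * t)" for d t
  proof -
    have "exp (2 * of_real pi * \<i> * of_real t) = cis (2 * pi * t)"
      by (simp add: cis_conv_exp mult_ac)
    moreover have "cis (2 * pi * t) ^ d = cis (real d * (2 * pi * t))" by (rule Complex.DeMoivre)
    moreover have "real d * (2 * pi * t) = 2 * pi * (real d * t)" by simp
    ultimately have "poly (monom 1 d - 1) (exp (2 * of_real pi * \<i> * of_real t)) = cis (2 * pi * (real d * t)) - 1"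
      by (simp add: poly_monom)
    then show ?thesis by (simp add: log_dist_def norm_minus_commute)
  qed
  then show ?thesis by (simp add: multiple_mahler_def)
qed

text \<open>The substitution (x, y, z) = (a k, b l, c m) multiplies each product of absolute values
  by a b c, hence the division by it.\<close>

lemma zero_sum_triples_has_sum:
  fixes a b c :: nat
  assumes pos: "a > 0" "b > 0" "c > 0"
  shows "((\<lambda>(x, y, z). 1 / real_of_int (\<bar>x\<bar> * \<bar>y\<bar> * \<bar>z\<bar>)) has_sum
    (- 8 * multiple_mahler (monom 1 a - 1) (monom 1 b - 1) (monom 1 c - 1) / (real a * real b * real c)))
    (zero_sum_triples a b c)"
proof -
  let ?h = "\<lambda>(x, y, z). 1 / real_of_int (\<bar>x\<bar> * \<bar>y\<bar> * \<bar>z\<bar>)"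
  let ?m = "multiple_mahler (monom 1 a - 1) (monom 1 b - 1) (monom 1 c - 1)"
  have "((\<lambda>p. ?h p * (1 / (real a * real b * real c))) has_sum (- 8 * ?m * (1 / (real a * real b * real c))))
      (relation_triples a b c)"
    unfolding multiple_mahler_eq_log_dist by (intro has_sum_cmult_left relation_triples_has_sum pos)
  also have "?this \<longleftrightarrow> (?h has_sum (- 8 * ?m / (real a * real b * real c))) (zero_sum_triples a b c)"
    by (rule has_sum_reindex_bij_witness[of _
          "\<lambda>(x, y, z). (x div int a, y div int b, z div int c)" "\<lambda>(k, l, m). (int a * k, int b * l, int c * m)"])
      (use pos in \<open>auto simp: relation_triples_def zero_sum_triples_def abs_mult mult_ac\<close>)
  finally show ?thesis .
qed

section \<open>Combination of the three signed sums\<close>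

text \<open>Lets \<open>signed_triples_has_sum\<close>, which distinguishes the last entry, be
  applied to each of the three entries in turn.\<close>

lemma has_sum_zero_sum_triples_rotate:
  "((\<lambda>(x, y, z). f x y z) has_sum s) (zero_sum_triples a b c) \<longleftrightarrow>
   ((\<lambda>(x, y, z). f z x y) has_sum s) (zero_sum_triples b c a)"
  by (rule has_sum_reindex_bij_witness[of _ "\<lambda>(x, y, z). (z, x, y)" "\<lambda>(x, y, z). (y, z, x)"])
    (auto simp: zero_sum_triples_def)

text \<open>Of three nonzero integers with sum zero, exactly two have the same sign.\<close>

lemma inverse_abs_mult3_zero_sum:
  fixes x y z :: int
  assumes "x + y + z = 0"
  shows "1 / real_of_int (\<bar>x\<bar> * \<bar>y\<bar> * \<bar>z\<bar>) =
    - (1 / real_of_int (x * y * \<bar>z\<bar>) + 1 / real_of_int (y * z * \<bar>x\<bar>) + 1 / real_of_int (z * x * \<bar>y\<bar>))"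
proof (cases "x = 0 \<or> y = 0 \<or> z = 0")
  case False
  then have nz: "x \<noteq> 0" "y \<noteq> 0" "z \<noteq> 0" by auto
  \<comment> \<open>The signed term that pairs the two entries of equal sign is positive, the other
    two are negative; so the three add up to - 1 / |x y z|.\<close>
  consider "x > 0" "y > 0" "z < 0" | "x > 0" "y < 0" "z > 0" | "x > 0" "y < 0" "z < 0"
    | "x < 0" "y > 0" "z > 0" | "x < 0" "y > 0" "z < 0" | "x < 0" "y < 0" "z > 0"
    using nz assms by linarith
  then show ?thesis by cases (simp_all add: mult_ac)
qed auto

theorem theorem10:
  fixes a b c :: nat
  assumes "a > 0" and "b > 0" and "c > 0"
    and "gcd (gcd a b) c = 1"
  shows "- 2 * multiple_mahler (monom 1 a - 1) (monom 1 b - 1) (monom 1 c - 1) =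
      real a * real b * real c *
        (1 / real (lcm a b) ^ 3 + 1 / real (lcm b c) ^ 3 + 1 / real (lcm c a) ^ 3) * zeta 3
      - pi / (2 * real c * real (gcd a b)) * cot_sum a b c
      - pi / (2 * real b * real (gcd a c)) * cot_sum a c b
      - pi / (2 * real a * real (gcd b c)) * cot_sum b c a
      - pi / (2 * real c * real (gcd b a)) * cot_sum b a c
      - pi / (2 * real b * real (gcd c a)) * cot_sum c a b
      - pi / (2 * real a * real (gcd c b)) * cot_sum c b a"
proof -
  let ?m = "multiple_mahler (monom 1 a - 1) (monom 1 b - 1) (monom 1 c - 1)"
  \<comment> \<open>The value of the signed sum in which the third entry is distinguished; all three
    are needed, with cyclically rotated arguments.\<close>
  define V where "V a b c = 2 * (pi / (real (lcm a b) * real (c * gcd a b) ^ 2) * (cot_sum a b c + cot_sum b a c)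
      - zeta 3 * (1 / real (lcm a c) ^ 3 + 1 / real (lcm b c) ^ 3))" for a b c
  let ?W = "\<lambda>x y z. 1 / real_of_int (\<bar>x\<bar> * \<bar>y\<bar> * \<bar>z\<bar>)"
  note pos = assms(1-3)
  have W: "((\<lambda>(x, y, z). ?W x y z) has_sum (- 8 * ?m / (real a * real b * real c))) (zero_sum_triples a b c)"
    using zero_sum_triples_has_sum[OF pos] .
  have Wrot: "(\<lambda>(x, y, z). ?W z x y) = (\<lambda>(x, y, z). ?W x y z)" by (auto simp: fun_eq_iff mult_ac)
  have W2: "((\<lambda>(x, y, z). ?W x y z) has_sum (- 8 * ?m / (real a * real b * real c))) (zero_sum_triples b c a)"
    using iffD1[OF has_sum_zero_sum_triples_rotate[of ?W a b c] W] unfolding Wrot .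
  have W3: "((\<lambda>(x, y, z). ?W x y z) has_sum (- 8 * ?m / (real a * real b * real c))) (zero_sum_triples c a b)"
    using iffD1[OF has_sum_zero_sum_triples_rotate[of ?W b c a] W2] unfolding Wrot .
  note s1 = has_sum_imp_summable[OF W] and s2 = has_sum_imp_summable[OF W2] and s3 = has_sum_imp_summable[OF W3]
  have g2: "gcd (gcd b c) a = 1" and g3: "gcd (gcd c a) b = 1"
    using assms(4) by (simp_all add: ac_simps)
  let ?v = "\<lambda>x y z. 1 / real_of_int (x * y * \<bar>z\<bar>)"
  have v1: "((\<lambda>(x, y, z). ?v x y z) has_sum V a b c) (zero_sum_triples a b c)"
    unfolding V_def by (rule signed_triples_has_sum[OF pos assms(4) s1])
  have "((\<lambda>(x, y, z). ?v x y z) has_sum V b c a) (zero_sum_triples b c a)"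
    unfolding V_def by (rule signed_triples_has_sum[OF pos(2,3,1) g2 s2])
  then have v2: "((\<lambda>(x, y, z). ?v y z x) has_sum V b c a) (zero_sum_triples a b c)"
    unfolding has_sum_zero_sum_triples_rotate[of "\<lambda>x y z. ?v y z x"] .
  have "((\<lambda>(x, y, z). ?v x y z) has_sum V c a b) (zero_sum_triples c a b)"
    unfolding V_def by (rule signed_triples_has_sum[OF pos(3,1,2) g3 s3])
  then have v3: "((\<lambda>(x, y, z). ?v z x y) has_sum V c a b) (zero_sum_triples a b c)"
    unfolding has_sum_zero_sum_triples_rotate[of ?v c a b] .
  have "((\<lambda>p. - ((case p of (x, y, z) \<Rightarrow> ?v x y z) + (case p of (x, y, z) \<Rightarrow> ?v y z x) +
      (case p of (x, y, z) \<Rightarrow> ?v z x y))) has_sum (- (V a b c + V b c a + V c a b))) (zero_sum_triples a b c)"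
    by (intro has_sum_uminusI has_sum_add v1 v2 v3)
  also have "?this \<longleftrightarrow> ((\<lambda>(x, y, z). ?W x y z) has_sum (- (V a b c + V b c a + V c a b))) (zero_sum_triples a b c)"
    by (rule has_sum_cong) (auto simp only: zero_sum_triples_def split: prod.split dest!: inverse_abs_mult3_zero_sum)
  finally have "- 8 * ?m / (real a * real b * real c) = - (V a b c + V b c a + V c a b)"
    using W has_sum_unique by blast
  then have m: "- 2 * ?m = - (real a * real b * real c) * (V a b c + V b c a + V c a b) / 4"
    using pos by (simp add: field_simps)
  \<comment> \<open>The identity d e = lcm d e * gcd d e reduces the prefactor to pi / (f gcd d e),
    twice the one in the final formula.\<close>
  have V: "real d * real e * real f * V d e f =
      4 * (pi / (2 * real f * real (gcd d e))) * (cot_sum d e f + cot_sum e d f)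
      - 2 * (real d * real e * real f) * zeta 3 * (1 / real (lcm d f) ^ 3 + 1 / real (lcm e f) ^ 3)"
    if "d > 0" "e > 0" "f > 0" for d e f
  proof -
    have "real d * real e = real (lcm d e) * real (gcd d e)"
      by (metis of_nat_mult prod_gcd_lcm_nat mult.commute)
    moreover have "real (lcm d e) > 0" "real (gcd d e) > 0" using that by (auto simp: lcm_pos_nat)
    ultimately have eq: "real d * real e * real f * (pi / (real (lcm d e) * real (f * gcd d e) ^ 2)) =
        2 * (pi / (2 * real f * real (gcd d e)))"
      using that by (simp add: field_simps power2_eq_square)
    have "A * (2 * (P * S - Z * T)) = 2 * (A * P) * S - 2 * A * Z * T" for A P S Z T :: real
      by (simp add: algebra_simps)
    then show ?thesis unfolding V_def by (simp only: eq)
  qed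
  \<comment> \<open>Abstracting these quantities leaves a polynomial identity: each lcm term occurs
    in two of the three values with coefficient -2, so division by -4 leaves 1, while every
    cotangent sum has coefficient 4 and is left with -1.\<close>
  define A p q s u v w where "A = real a * real b * real c"
    and "p = pi / (2 * real c * real (gcd a b))" and "q = pi / (2 * real b * real (gcd a c))"
    and "s = pi / (2 * real a * real (gcd b c))"
    and "u = 1 / real (lcm a b) ^ 3" and "v = 1 / real (lcm b c) ^ 3" and "w = 1 / real (lcm c a) ^ 3"
  have "A * V a b c = 4 * p * (cot_sum a b c + cot_sum b a c) - 2 * A * zeta 3 * (w + v)"
    using V[OF pos] by (simp only: A_def p_def w_def v_def lcm.commute[of c a])
  moreover have "A * V b c a = 4 * s * (cot_sum b c a + cot_sum c b a) - 2 * A * zeta 3 * (u + w)"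
    using V[OF pos(2,3,1)] by (simp only: A_def s_def u_def w_def lcm.commute[of b a] mult_ac)
  moreover have "A * V c a b = 4 * q * (cot_sum c a b + cot_sum a c b) - 2 * A * zeta 3 * (v + u)"
    using V[OF pos(3,1,2)] by (simp only: A_def q_def u_def v_def gcd.commute[of c a] lcm.commute[of c b] mult_ac)
  moreover have "- 2 * ?m = - (A * V a b c + A * V b c a + A * V c a b) / 4"
    using m by (simp add: A_def algebra_simps)
  ultimately have "- 2 * ?m = A * (u + v + w) * zeta 3 - p * cot_sum a b c - q * cot_sum a c b - s * cot_sum b c a
      - p * cot_sum b a c - q * cot_sum c a b - s * cot_sum c b a"
    by (simp add: algebra_simps)
  then show ?thesis
    unfolding A_def p_def q_def s_def u_def v_def w_def
    by (simp only: gcd.commute[of b a] gcd.commute[of c a] gcd.commute[of c b])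
qed

end
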